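(* $\mathsf{ZF}$ proves that if $\mathbb P$ is a $\mathrm{CCC}_3$ notion of forcing, then for every $V$-generic filter $G\subseteq\mathbb P$, Bukovský's condition holds for $V\subseteq V[G]$ with $\kappa=\aleph_1$; that is, for every $x\in V$ and every function $f\colon x\to V$ in $V[G]$, there is a function $g\colon x\to V$ in $V$ such that for all $u\in x$, $V\models |g(u)|<\aleph_1$ and $V[G]\models f(u)\in g(u)$.
   Context: A notion of forcing is a preordered set $\mathbb P$ with a maximum. Conditions are compatible if they have a common extension. $D\subseteq\mathbb P$ is predense if every $p\in\mathbb P$ is compatible with some member of $D$. $\mathbb P$ is $\mathrm{CCC}_3$ if every predense subset of $\mathbb P$ contains a countable predense subset. $|g(u)|<\aleph_1$ means that $g(u)$ is a countable set (possibly finite). *)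

theory Defs
  imports Main
begin

text \<open>
  ``\<open>ZF\<close> proves'' is read semantically: the theorem is about an arbitrary model
  of first-order \<open>ZF\<close>, given by a universe \<open>U\<close> and a membership relation \<open>E\<close>.  The model need
  not be countable, well-founded or standard, and it need not satisfy the axiom of choice.
  Notions taking \<open>U E\<close> as arguments are relativised to that model.
\<close>

datatype fm = Mem nat nat | Eq nat nat | Neg fm | Conj fm fm | Forall nat fm

primrec sat :: "'a set \<Rightarrow> ('a \<Rightarrow> 'a \<Rightarrow> bool) \<Rightarrow> (nat \<Rightarrow> 'a) \<Rightarrow> fm \<Rightarrow> bool" where
  "sat U E e (Mem i j) \<longleftrightarrow> E (e i) (e j)"
| "sat U E e (Eq i j) \<longleftrightarrow> e i = e j"
| "sat U E e (Neg \<phi>) \<longleftrightarrow> \<not> sat U E e \<phi>"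
| "sat U E e (Conj \<phi> \<psi>) \<longleftrightarrow> sat U E e \<phi> \<and> sat U E e \<psi>"
| "sat U E e (Forall i \<phi>) \<longleftrightarrow> (\<forall>x\<in>U. sat U E (e(i := x)) \<phi>)"

definition elts :: "'a set \<Rightarrow> ('a \<Rightarrow> 'a \<Rightarrow> bool) \<Rightarrow> 'a \<Rightarrow> 'a set" where
  "elts U E x = {z \<in> U. E z x}"

definition is_upair :: "'a set \<Rightarrow> ('a \<Rightarrow> 'a \<Rightarrow> bool) \<Rightarrow> 'a \<Rightarrow> 'a \<Rightarrow> 'a \<Rightarrow> bool" where
  "is_upair U E c a b \<longleftrightarrow> elts U E c = {a, b}"

definition is_pair :: "'a set \<Rightarrow> ('a \<Rightarrow> 'a \<Rightarrow> bool) \<Rightarrow> 'a \<Rightarrow> 'a \<Rightarrow> 'a \<Rightarrow> bool" where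
  "is_pair U E c a b \<longleftrightarrow>
     (\<exists>s\<in>U. \<exists>d\<in>U. is_upair U E s a a \<and> is_upair U E d a b \<and> is_upair U E c s d)"

definition related :: "'a set \<Rightarrow> ('a \<Rightarrow> 'a \<Rightarrow> bool) \<Rightarrow> 'a \<Rightarrow> 'a \<Rightarrow> 'a \<Rightarrow> bool" where
  "related U E r a b \<longleftrightarrow> (\<exists>c\<in>elts U E r. is_pair U E c a b)"

definition inductive_set_in :: "'a set \<Rightarrow> ('a \<Rightarrow> 'a \<Rightarrow> bool) \<Rightarrow> 'a \<Rightarrow> bool" where
  "inductive_set_in U E I \<longleftrightarrow>
     (\<exists>z\<in>elts U E I. elts U E z = {}) \<and>
     (\<forall>n\<in>elts U E I. \<exists>s\<in>elts U E I. elts U E s = insert n (elts U E n))"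

text \<open>In the two axiom schemata the assignment \<open>e\<close> supplies the parameters.\<close>

definition separation :: "'a set \<Rightarrow> ('a \<Rightarrow> 'a \<Rightarrow> bool) \<Rightarrow> bool" where
  "separation U E \<longleftrightarrow>
     (\<forall>\<phi> e. range e \<subseteq> U \<longrightarrow>
        (\<forall>a\<in>U. \<exists>b\<in>U. elts U E b = {z \<in> elts U E a. sat U E (e(0 := z)) \<phi>}))"

definition replacement :: "'a set \<Rightarrow> ('a \<Rightarrow> 'a \<Rightarrow> bool) \<Rightarrow> bool" where
  "replacement U E \<longleftrightarrow>
     (\<forall>\<phi> e. range e \<subseteq> U \<longrightarrow>
        (\<forall>a\<in>U. (\<forall>x\<in>elts U E a. \<exists>!y. y \<in> U \<and> sat U E (e(0 := x, 1 := y)) \<phi>) \<longrightarrow>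
           (\<exists>b\<in>U. elts U E b = {y \<in> U. \<exists>x\<in>elts U E a. sat U E (e(0 := x, 1 := y)) \<phi>})))"

definition ZF_model :: "'a set \<Rightarrow> ('a \<Rightarrow> 'a \<Rightarrow> bool) \<Rightarrow> bool" where
  "ZF_model U E \<longleftrightarrow>
     U \<noteq> {} \<and>
     (\<forall>x\<in>U. \<forall>y\<in>U. elts U E x = elts U E y \<longrightarrow> x = y) \<and>
     (\<forall>x\<in>U. elts U E x \<noteq> {} \<longrightarrow> (\<exists>y\<in>elts U E x. elts U E y \<inter> elts U E x = {})) \<and>
     (\<forall>a\<in>U. \<forall>b\<in>U. \<exists>c\<in>U. is_upair U E c a b) \<and>
     (\<forall>x\<in>U. \<exists>u\<in>U. elts U E u = (\<Union>y\<in>elts U E x. elts U E y)) \<and>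
     (\<forall>x\<in>U. \<exists>p\<in>U. elts U E p = {y \<in> U. elts U E y \<subseteq> elts U E x}) \<and>
     (\<exists>I\<in>U. inductive_set_in U E I) \<and>
     separation U E \<and>
     replacement U E"

definition function_on :: "'a set \<Rightarrow> ('a \<Rightarrow> 'a \<Rightarrow> bool) \<Rightarrow> 'a \<Rightarrow> 'a \<Rightarrow> bool" where
  "function_on U E f x \<longleftrightarrow>
     (\<forall>c\<in>elts U E f. \<exists>u\<in>elts U E x. \<exists>y\<in>U. is_pair U E c u y) \<and>
     (\<forall>u\<in>elts U E x. \<exists>!y. y \<in> U \<and> related U E f u y)"

definition is_omega :: "'a set \<Rightarrow> ('a \<Rightarrow> 'a \<Rightarrow> bool) \<Rightarrow> 'a \<Rightarrow> bool" where
  "is_omega U E w \<longleftrightarrow>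
     inductive_set_in U E w \<and>
     (\<forall>I\<in>U. inductive_set_in U E I \<longrightarrow> elts U E w \<subseteq> elts U E I)"

text \<open>Countability in the sense of the model: there is, in \<open>U\<close>, an injection into \<open>\<omega>\<close>.\<close>

definition countable_in :: "'a set \<Rightarrow> ('a \<Rightarrow> 'a \<Rightarrow> bool) \<Rightarrow> 'a \<Rightarrow> bool" where
  "countable_in U E x \<longleftrightarrow>
     (\<exists>w\<in>U. \<exists>h\<in>U. is_omega U E w \<and> function_on U E h x \<and>
        (\<forall>u\<in>elts U E x. \<forall>n\<in>U. related U E h u n \<longrightarrow> n \<in> elts U E w) \<and>
        (\<forall>u\<in>elts U E x. \<forall>v\<in>elts U E x. \<forall>n\<in>U.
            related U E h u n \<and> related U E h v n \<longrightarrow> u = v))"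

text \<open>\<open>related U E le p q\<close> is \<open>p \<le> q\<close>, i.e. the condition \<open>p\<close> extends \<open>q\<close>.\<close>

definition forcing_notion :: "'a set \<Rightarrow> ('a \<Rightarrow> 'a \<Rightarrow> bool) \<Rightarrow> 'a \<Rightarrow> 'a \<Rightarrow> bool" where
  "forcing_notion U E P le \<longleftrightarrow>
     P \<in> U \<and> le \<in> U \<and>
     (\<forall>c\<in>elts U E le. \<exists>p\<in>elts U E P. \<exists>q\<in>elts U E P. is_pair U E c p q) \<and>
     (\<forall>p\<in>elts U E P. related U E le p p) \<and>
     (\<forall>p\<in>elts U E P. \<forall>q\<in>elts U E P. \<forall>r\<in>elts U E P.
        related U E le p q \<and> related U E le q r \<longrightarrow> related U E le p r) \<and>
     (\<exists>m\<in>elts U E P. \<forall>p\<in>elts U E P. related U E le p m)"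

definition compatible :: "'a set \<Rightarrow> ('a \<Rightarrow> 'a \<Rightarrow> bool) \<Rightarrow> 'a \<Rightarrow> 'a \<Rightarrow> 'a \<Rightarrow> 'a \<Rightarrow> bool" where
  "compatible U E P le p q \<longleftrightarrow>
     (\<exists>r\<in>elts U E P. related U E le r p \<and> related U E le r q)"

definition predense :: "'a set \<Rightarrow> ('a \<Rightarrow> 'a \<Rightarrow> bool) \<Rightarrow> 'a \<Rightarrow> 'a \<Rightarrow> 'a \<Rightarrow> bool" where
  "predense U E P le D \<longleftrightarrow>
     elts U E D \<subseteq> elts U E P \<and>
     (\<forall>p\<in>elts U E P. \<exists>d\<in>elts U E D. compatible U E P le p d)"

definition CCC3 :: "'a set \<Rightarrow> ('a \<Rightarrow> 'a \<Rightarrow> bool) \<Rightarrow> 'a \<Rightarrow> 'a \<Rightarrow> bool" where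
  "CCC3 U E P le \<longleftrightarrow>
     (\<forall>D\<in>U. predense U E P le D \<longrightarrow>
        (\<exists>A\<in>U. elts U E A \<subseteq> elts U E D \<and> countable_in U E A \<and> predense U E P le A))"

definition dense :: "'a set \<Rightarrow> ('a \<Rightarrow> 'a \<Rightarrow> bool) \<Rightarrow> 'a \<Rightarrow> 'a \<Rightarrow> 'a \<Rightarrow> bool" where
  "dense U E P le D \<longleftrightarrow>
     elts U E D \<subseteq> elts U E P \<and>
     (\<forall>p\<in>elts U E P. \<exists>d\<in>elts U E D. related U E le d p)"

text \<open>The filter \<open>G\<close> is an arbitrary collection of conditions, not necessarily in the ground model.\<close>

definition generic_filter ::
    "'a set \<Rightarrow> ('a \<Rightarrow> 'a \<Rightarrow> bool) \<Rightarrow> 'a \<Rightarrow> 'a \<Rightarrow> 'a set \<Rightarrow> bool" where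
  "generic_filter V E P le G \<longleftrightarrow>
     G \<subseteq> elts V E P \<and> G \<noteq> {} \<and>
     (\<forall>p\<in>G. \<forall>q\<in>elts V E P. related V E le p q \<longrightarrow> q \<in> G) \<and>
     (\<forall>p\<in>G. \<forall>q\<in>G. \<exists>r\<in>G. related V E le r p \<and> related V E le r q) \<and>
     (\<forall>D\<in>V. dense V E P le D \<longrightarrow> G \<inter> elts V E D \<noteq> {})"

text \<open>
  A \<open>P\<close>-name is a set of pairs \<open>(\<tau>, p)\<close> with \<open>\<tau>\<close> a \<open>P\<close>-name and \<open>p \<in> P\<close>.  As \<open>E\<close> need not be
  well-founded, this recursion, and the one for the evaluation
  \<open>\<sigma>\<^sup>G = {\<tau>\<^sup>G | \<exists>p\<in>G. (\<tau>, p) \<in> \<sigma>}\<close>, have to be carried out inside the model: \<open>\<sigma>\<close> is a name iff it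
  lies in some set \<open>T\<close> closed under the defining clause, and \<open>y\<close> is its value iff \<open>h(\<sigma>) = y\<close>
  for some function \<open>h\<close> on such a \<open>T\<close> obeying the recursion equation.
\<close>

definition name_closed :: "'a set \<Rightarrow> ('a \<Rightarrow> 'a \<Rightarrow> bool) \<Rightarrow> 'a \<Rightarrow> 'a \<Rightarrow> bool" where
  "name_closed U E P T \<longleftrightarrow>
     (\<forall>\<tau>\<in>elts U E T. \<forall>c\<in>elts U E \<tau>. \<exists>\<pi>\<in>elts U E T. \<exists>p\<in>elts U E P. is_pair U E c \<pi> p)"

definition is_name :: "'a set \<Rightarrow> ('a \<Rightarrow> 'a \<Rightarrow> bool) \<Rightarrow> 'a \<Rightarrow> 'a \<Rightarrow> bool" where
  "is_name U E P \<sigma> \<longleftrightarrow> (\<exists>T\<in>U. name_closed U E P T \<and> \<sigma> \<in> elts U E T)"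

definition name_value ::
    "'a set \<Rightarrow> ('a \<Rightarrow> 'a \<Rightarrow> bool) \<Rightarrow> 'a \<Rightarrow> 'a \<Rightarrow> 'a \<Rightarrow> 'a \<Rightarrow> bool" where
  "name_value U E P G \<sigma> y \<longleftrightarrow>
     (\<exists>T\<in>U. \<exists>h\<in>U. name_closed U E P T \<and> \<sigma> \<in> elts U E T \<and> function_on U E h T \<and>
        (\<forall>\<tau>\<in>elts U E T. \<forall>v\<in>U. related U E h \<tau> v \<longrightarrow>
           elts U E v =
             {z \<in> U. \<exists>\<pi>\<in>elts U E T. \<exists>p\<in>elts U E G. related U E \<tau> \<pi> p \<and> related U E h \<pi> z}) \<and>
        related U E h \<sigma> y)"

text \<open>
  \<open>W\<close> is the generic extension \<open>V[G]\<close>: a model of \<open>ZF\<close> having \<open>V\<close> as a transitive subclass and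
  \<open>G\<close> as an element, every element of which is the value \<open>\<sigma>\<^sup>G\<close> of some \<open>P\<close>-name \<open>\<sigma>\<close> in \<open>V\<close>.
  (That conversely every \<open>P\<close>-name in \<open>V\<close> has a value in \<open>W\<close> follows from \<open>ZF\<close> in \<open>W\<close>.)
\<close>

definition generic_extension ::
    "'a set \<Rightarrow> 'a set \<Rightarrow> ('a \<Rightarrow> 'a \<Rightarrow> bool) \<Rightarrow> 'a \<Rightarrow> 'a set \<Rightarrow> bool" where
  "generic_extension V W E P G \<longleftrightarrow>
     ZF_model W E \<and> V \<subseteq> W \<and> (\<forall>x\<in>V. elts W E x \<subseteq> V) \<and>
     (\<exists>\<Gamma>\<in>W. elts W E \<Gamma> = G \<and>
        (\<forall>y\<in>W. \<exists>\<sigma>\<in>V. is_name V E P \<sigma> \<and> name_value W E P \<Gamma> \<sigma> y))"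

definition bukovsky_aleph1 :: "'a set \<Rightarrow> 'a set \<Rightarrow> ('a \<Rightarrow> 'a \<Rightarrow> bool) \<Rightarrow> bool" where
  "bukovsky_aleph1 V W E \<longleftrightarrow>
     (\<forall>x\<in>V. \<forall>f\<in>W.
        function_on W E f x \<and> (\<forall>u\<in>elts W E x. \<forall>y\<in>W. related W E f u y \<longrightarrow> y \<in> V) \<longrightarrow>
        (\<exists>g\<in>V. function_on V E g x \<and>
           (\<forall>u\<in>elts V E x. \<exists>c\<in>V. related V E g u c \<and> countable_in V E c \<and>
              (\<exists>y\<in>W. related W E f u y \<and> y \<in> elts W E c))))"

end

theory Submission
  imports Defs
begin

text \<open>
  For a name \<open>\<sigma>\<close> of \<open>f\<close>, only one fragment of the forcing relation is needed: that \<open>p\<close> forces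
  a name \<open>\<pi>\<close> to denote a given set \<open>c\<close> of the ground model.  Its recursion equation is monotone,
  so it can be solved inside \<open>V\<close> by a greatest fixed point; a condition decides at most one
  value for each name, hence by replacement the solution is a set, without bounding \<open>c\<close> in advance.
  The truth lemma for this fragment is proved by induction on names inside \<open>W\<close>.

  Call \<open>y\<close> a possible value of \<open>f(u)\<close> if some \<open>p\<close> decides \<open>(u, y) \<in> \<sigma>\<close> and no extension of \<open>p\<close>
  decides \<open>(u, y') \<in> \<sigma>\<close> for another \<open>y'\<close>, and let \<open>g(u)\<close> be the set of all possible values, so that no
  choice is involved.  The conditions that decide a possible value, together with those having
  no extension that does, form a predense set, and a countable predense subset of it
  already decides all possible values, since compatible conditions decide the same one.
\<close>

section \<open>Definability with parameters\<close>

primrec rename_fm :: "(nat \<Rightarrow> nat) \<Rightarrow> fm \<Rightarrow> fm" where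
  "rename_fm f (Mem i j) = Mem (f i) (f j)"
| "rename_fm f (Eq i j) = Eq (f i) (f j)"
| "rename_fm f (Neg \<phi>) = Neg (rename_fm f \<phi>)"
| "rename_fm f (Conj \<phi> \<psi>) = Conj (rename_fm f \<phi>) (rename_fm f \<psi>)"
| "rename_fm f (Forall i \<phi>) = Forall (f i) (rename_fm f \<phi>)"

text \<open>Injectivity rules out capture: updating \<open>e\<close> at \<open>f i\<close> changes
  \<open>e \<circ> f\<close> at \<open>i\<close> only, so bound variables may be renamed together
  with free ones.\<close>

lemma sat_rename_fm:
  assumes "inj f"
  shows "sat U E e (rename_fm f \<phi>) \<longleftrightarrow> sat U E (e \<circ> f) \<phi>"
proof (induction \<phi> arbitrary: e)
  case (Forall i \<phi>)
  have "e(f i := x) \<circ> f = (e \<circ> f)(i := x)" for x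
    using assms by (auto simp: fun_eq_iff inj_eq)
  then show ?case by (simp only: rename_fm.simps sat.simps Forall)
qed auto

definition interleave :: "(nat \<Rightarrow> 'a) \<Rightarrow> (nat \<Rightarrow> 'a) \<Rightarrow> nat \<Rightarrow> 'a" where
  "interleave e c n = (if even n then e (n div 2) else c (n div 2))"

lemma interleave_simps [simp]:
  "interleave e c (2 * n) = e n" "interleave e c (Suc (2 * n)) = c n"
  "interleave e c 0 = e 0" "interleave e c (Suc 0) = c 0"
  by (auto simp: interleave_def)

lemma double_neq_Suc_double: "2 * m \<noteq> Suc (2 * n)" "Suc (2 * n) \<noteq> 2 * m" for m n :: nat
  by presburger+

lemma interleave_in: "range e \<subseteq> U \<Longrightarrow> range c \<subseteq> U \<Longrightarrow> range (interleave e c) \<subseteq> U"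
  by (auto simp: interleave_def)

text \<open>
  Definability with parameters: an assignment \<open>e\<close> supplies the variables and \<open>c\<close> the parameters,
  at even and odd indices respectively, so that injective renamings suffice to combine formulas.
\<close>

definition definable :: "'a set \<Rightarrow> ('a \<Rightarrow> 'a \<Rightarrow> bool) \<Rightarrow> ((nat \<Rightarrow> 'a) \<Rightarrow> bool) \<Rightarrow> bool" where
  "definable U E Q \<longleftrightarrow>
     (\<exists>\<phi> c. range c \<subseteq> U \<and> (\<forall>e. range e \<subseteq> U \<longrightarrow> (Q e \<longleftrightarrow> sat U E (interleave e c) \<phi>)))"

section \<open>Atomic terms and closure of definability under logical operations\<close>

definition is_term :: "'a set \<Rightarrow> ((nat \<Rightarrow> 'a) \<Rightarrow> 'a) \<Rightarrow> bool" where
  "is_term U t \<longleftrightarrow> (\<exists>k. t = (\<lambda>e. e k)) \<or> (\<exists>a\<in>U. t = (\<lambda>_. a))"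

lemma is_term_var: "is_term U (\<lambda>e. e k)"
  by (auto simp: is_term_def)

lemma is_term_const: "a \<in> U \<Longrightarrow> is_term U (\<lambda>e. a)"
  by (auto simp: is_term_def)

lemma is_term_shift: "is_term U t \<Longrightarrow> is_term U (\<lambda>e. t (\<lambda>i. e (Suc i)))"
  by (auto simp: is_term_def)

lemma is_term_in: "is_term U t \<Longrightarrow> range e \<subseteq> U \<Longrightarrow> t e \<in> U"
  by (auto simp: is_term_def)

lemma definable_cong:
  assumes "definable U E Q'" "\<And>e. range e \<subseteq> U \<Longrightarrow> Q e \<longleftrightarrow> Q' e"
  shows "definable U E Q"
  using assms unfolding definable_def by metis

lemma definable_not:
  assumes "definable U E Q" shows "definable U E (\<lambda>e. \<not> Q e)"
proof -
  obtain \<phi> c where "range c \<subseteq> U" "\<And>e. range e \<subseteq> U \<Longrightarrow> Q e \<longleftrightarrow> sat U E (interleave e c) \<phi>"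
    using assms unfolding definable_def by metis
  then show ?thesis unfolding definable_def
    by (intro exI[of _ "Neg \<phi>"] exI[of _ c]) auto
qed

lemma definable_conj:
  assumes "definable U E Q" "definable U E Q'"
  shows "definable U E (\<lambda>e. Q e \<and> Q' e)"
proof -
  obtain \<phi> c where 1: "range c \<subseteq> U" "\<And>e. range e \<subseteq> U \<Longrightarrow> Q e \<longleftrightarrow> sat U E (interleave e c) \<phi>"
    using assms unfolding definable_def by metis
  obtain \<phi>' c' where 2: "range c' \<subseteq> U" "\<And>e. range e \<subseteq> U \<Longrightarrow> Q' e \<longleftrightarrow> sat U E (interleave e c') \<phi>'"
    using assms unfolding definable_def by metis
  \<comment> \<open>Parameter \<open>k\<close> of \<open>c\<close> moves to parameter position
    \<open>2 * k\<close> of the merged sequence, parameter \<open>k\<close> of \<open>c'\<close> to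
    position \<open>2 * k + 1\<close>. Even indices, which hold the variables, stay fixed.\<close>
  define f g :: "nat \<Rightarrow> nat" where "f n = (if even n then n else 2 * n - 1)"
    and "g n = (if even n then n else 2 * n + 1)" for n
  have inj: "inj f" "inj g"
    by (rule injI; simp add: f_def g_def split: if_splits; presburger)+
  have comp: "interleave e (interleave c c') \<circ> f = interleave e c"
    "interleave e (interleave c c') \<circ> g = interleave e c'" for e :: "nat \<Rightarrow> 'a"
    unfolding fun_eq_iff
    by (auto simp: f_def g_def interleave_def double_neq_Suc_double elim!: oddE)
  from 1 2 interleave_in[OF 1(1) 2(1)] show ?thesis unfolding definable_def
    by (intro exI[of _ "Conj (rename_fm f \<phi>) (rename_fm g \<phi>')"] exI[of _ "interleave c c'"])
      (simp add: sat_rename_fm inj comp)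
qed

text \<open>De Bruijn convention: in the premise the bound variable has index 0 and the outer
  variables are shifted up by one.\<close>

lemma definable_all:
  assumes "definable U E (\<lambda>e. Q (\<lambda>i. e (Suc i)) (e 0))"
  shows "definable U E (\<lambda>e. \<forall>x\<in>U. Q e x)"
proof -
  obtain \<phi> c where 1: "range c \<subseteq> U"
    "\<And>e. range e \<subseteq> U \<Longrightarrow> Q (\<lambda>i. e (Suc i)) (e 0) \<longleftrightarrow> sat U E (interleave e c) \<phi>"
    using assms unfolding definable_def by metis
  \<comment> \<open>The renaming undoes this shift: variable 0 goes to the first parameter slot, the
    other variables drop by one, and the parameters move up by one to vacate that slot.\<close>
  define f where "f n = (if n = 0 then 1 else if even n then n - 2 else n + 2)" for n :: nat
  have inj: "inj f"
    by (rule injI; simp add: f_def split: if_splits; presburger)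
  \<comment> \<open>The entry \<open>c 0\<close> at position 0 is a filler that the quantifier
    overwrites.\<close>
  define c0 where "c0 = (\<lambda>n. case n of 0 \<Rightarrow> c 0 | Suc m \<Rightarrow> c m)"
  define b where "b e x = (\<lambda>n. case n of 0 \<Rightarrow> x | Suc m \<Rightarrow> e m)" for e and x :: 'a
  have f: "(interleave e c0)(Suc 0 := x) \<circ> f = interleave (b e x) c" for e x
  proof
    fix n
    show "((interleave e c0)(Suc 0 := x) \<circ> f) n = interleave (b e x) c n"
    proof (cases "even n")
      case True
      then obtain k where "n = 2 * k" by blast
      then show ?thesis by (cases k) (auto simp: f_def b_def interleave_def)
    next
      case False
      then obtain k where "n = 2 * k + 1" by (auto elim: oddE)
      then show ?thesis by (auto simp: f_def c0_def interleave_def)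
    qed
  qed
  have "range c0 \<subseteq> U" using 1 by (auto simp: c0_def split: nat.splits)
  moreover have "(\<forall>x\<in>U. Q e x) \<longleftrightarrow> sat U E (interleave e c0) (Forall 1 (rename_fm f \<phi>))"
    if e: "range e \<subseteq> U" for e
  proof -
    have "Q e x \<longleftrightarrow> sat U E (interleave (b e x) c) \<phi>" if "x \<in> U" for x
    proof -
      have "range (b e x) \<subseteq> U" using e that by (auto simp: b_def image_subset_iff split: nat.splits)
      then show ?thesis using 1(2)[of "b e x"] by (simp add: b_def)
    qed
    then show ?thesis by (simp add: sat_rename_fm inj f)
  qed
  ultimately show ?thesis unfolding definable_def by blast
qed

text \<open>The parameter position \<open>m\<close> is left open so that the parameters of two terms
  can be put side by side in one sequence. If \<open>t\<close> is a variable, any \<open>a\<close>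
  will do.\<close>

lemma is_term_index:
  assumes "is_term U t" "U \<noteq> {}"
  shows "\<exists>a\<in>U. \<forall>m. \<exists>i. \<forall>c e. c m = a \<longrightarrow> interleave e c i = t e"
proof -
  consider k where "t = (\<lambda>e. e k)" | a where "a \<in> U" "t = (\<lambda>_. a)"
    using assms unfolding is_term_def by blast
  then show ?thesis
  proof cases
    case 1
    have "\<forall>m. \<exists>i. \<forall>c e. c m = a \<longrightarrow> interleave e c i = t e" for a
      by (intro allI exI[of _ "2 * k"]) (simp add: 1)
    then show ?thesis using assms by blast
  next
    case 2
    have "\<forall>m. \<exists>i. \<forall>c e. c m = a \<longrightarrow> interleave e c i = t e"
      using 2 interleave_simps(2) by metis
    then show ?thesis using 2 by blast
  qed
qed

lemma is_term_index2:
  assumes "is_term U t" "is_term U s" "U \<noteq> {}"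
  obtains c i j where "range c \<subseteq> U" "\<And>e. interleave e c i = t e" "\<And>e. interleave e c j = s e"
proof -
  obtain a where a: "a \<in> U" "\<forall>m. \<exists>i. \<forall>c e. c m = a \<longrightarrow> interleave e c i = t e"
    using is_term_index assms by metis
  obtain b where b: "b \<in> U" "\<forall>m. \<exists>i. \<forall>c e. c m = b \<longrightarrow> interleave e c i = s e"
    using is_term_index assms by metis
  define c where "c n = (if n = 0 then a else b)" for n :: nat
  have "range c \<subseteq> U" "c 0 = a" "c 1 = b" using a b by (auto simp: c_def)
  with a b that show thesis by metis
qed

lemma definable_mem_rel:
  assumes "is_term U t" "is_term U s" "U \<noteq> {}"
  shows "definable U E (\<lambda>e. E (t e) (s e))"
proof -
  obtain c i j where "range c \<subseteq> U" "\<And>e. interleave e c i = t e" "\<And>e. interleave e c j = s e"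
    using is_term_index2 assms by metis
  then show ?thesis unfolding definable_def
    by (intro exI[of _ "Mem i j"] exI[of _ c]) auto
qed

lemma definable_eq:
  assumes "is_term U t" "is_term U s" "U \<noteq> {}"
  shows "definable U E (\<lambda>e. t e = s e)"
proof -
  obtain c i j where "range c \<subseteq> U" "\<And>e. interleave e c i = t e" "\<And>e. interleave e c j = s e"
    using is_term_index2 assms by metis
  then show ?thesis unfolding definable_def
    by (intro exI[of _ "Eq i j"] exI[of _ c]) auto
qed

lemma definable_disj:
  assumes "definable U E Q" "definable U E Q'"
  shows "definable U E (\<lambda>e. Q e \<or> Q' e)"
  by (rule definable_cong[OF definable_not[OF definable_conj[OF definable_not definable_not]]])
    (use assms in auto)

lemma definable_imp:
  assumes "definable U E Q" "definable U E Q'"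
  shows "definable U E (\<lambda>e. Q e \<longrightarrow> Q' e)"
  by (rule definable_cong[OF definable_disj[OF definable_not[OF assms(1)] assms(2)]]) auto

lemma definable_iff:
  assumes "definable U E Q" "definable U E Q'"
  shows "definable U E (\<lambda>e. Q e \<longleftrightarrow> Q' e)"
  by (rule definable_cong[OF definable_conj[OF definable_imp[OF assms] definable_imp[OF assms(2,1)]]]) auto

lemma definable_ex:
  assumes "definable U E (\<lambda>e. Q (\<lambda>i. e (Suc i)) (e 0))"
  shows "definable U E (\<lambda>e. \<exists>x\<in>U. Q e x)"
proof (rule definable_cong)
  show "definable U E (\<lambda>e. \<not> (\<forall>x\<in>U. \<not> Q e x))"
    by (intro definable_not definable_all assms)
qed auto

lemma definable_const:
  assumes "U \<noteq> {}" shows "definable U E (\<lambda>e. b)"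
proof -
  obtain a where "a \<in> U" using assms by blast
  have "definable U E (\<lambda>e. a = a)"
    using \<open>a \<in> U\<close> by (intro definable_eq is_term_const) auto
  then have "definable U E (\<lambda>e. True)" "definable U E (\<lambda>e. False)"
    using definable_not by fastforce+
  then show ?thesis by (cases b) auto
qed

lemma definable_in_elts:
  assumes "is_term U t" "is_term U s" "U \<noteq> {}"
  shows "definable U E (\<lambda>e. t e \<in> elts U E (s e))"
  by (rule definable_cong[OF definable_mem_rel[OF assms]])
    (use is_term_in assms in \<open>auto simp: elts_def\<close>)

lemma definable_ball:
  assumes "is_term U t" "U \<noteq> {}" "definable U E (\<lambda>e. Q (\<lambda>i. e (Suc i)) (e 0))"
  shows "definable U E (\<lambda>e. \<forall>x\<in>elts U E (t e). Q e x)"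
proof (rule definable_cong)
  show "definable U E (\<lambda>e. \<forall>x\<in>U. x \<in> elts U E (t e) \<longrightarrow> Q e x)"
    by (intro definable_all definable_imp definable_in_elts is_term_var is_term_shift assms)
qed (auto simp: elts_def)

lemma definable_bex:
  assumes "is_term U t" "U \<noteq> {}" "definable U E (\<lambda>e. Q (\<lambda>i. e (Suc i)) (e 0))"
  shows "definable U E (\<lambda>e. \<exists>x\<in>elts U E (t e). Q e x)"
proof (rule definable_cong)
  show "definable U E (\<lambda>e. \<not> (\<forall>x\<in>elts U E (t e). \<not> Q e x))"
    by (intro definable_not definable_ball assms)
qed auto

lemma definable_is_upair:
  assumes "is_term U t" "is_term U s" "is_term U r" "U \<noteq> {}"
  shows "definable U E (\<lambda>e. is_upair U E (t e) (s e) (r e))"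
proof (rule definable_cong)
  show "definable U E (\<lambda>e. (\<forall>x\<in>U. x \<in> elts U E (t e) \<longleftrightarrow> x = s e \<or> x = r e))"
    by (intro definable_all definable_iff definable_disj definable_eq definable_in_elts
        is_term_var is_term_shift assms)
  show "is_upair U E (t e) (s e) (r e) \<longleftrightarrow> (\<forall>x\<in>U. x \<in> elts U E (t e) \<longleftrightarrow> x = s e \<or> x = r e)"
    if "range e \<subseteq> U" for e
  proof -
    have "s e \<in> U" "r e \<in> U" using is_term_in assms that by metis+
    then show ?thesis by (auto simp: is_upair_def elts_def set_eq_iff)
  qed
qed

lemma definable_is_pair:
  assumes "is_term U t" "is_term U s" "is_term U r" "U \<noteq> {}"
  shows "definable U E (\<lambda>e. is_pair U E (t e) (s e) (r e))"
  unfolding is_pair_def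
  by (intro definable_ex definable_conj definable_is_upair is_term_var is_term_shift assms)

lemma definable_related:
  assumes "is_term U t" "is_term U s" "is_term U r" "U \<noteq> {}"
  shows "definable U E (\<lambda>e. related U E (t e) (s e) (r e))"
  unfolding related_def
  by (intro definable_bex definable_is_pair is_term_var is_term_shift assms)

lemma definable_reindex:
  assumes "definable U E Q" "inj f"
  shows "definable U E (\<lambda>e. Q (e \<circ> f))"
proof -
  obtain \<phi> c where 1: "range c \<subseteq> U" "\<And>e. range e \<subseteq> U \<Longrightarrow> Q e \<longleftrightarrow> sat U E (interleave e c) \<phi>"
    using assms unfolding definable_def by metis
  define g where "g n = (if even n then 2 * f (n div 2) else n)" for n
  have "inj g"
  proof (rule injI)
    fix m n assume "g m = g n"
    then show "m = n"
      by (cases "even m"; cases "even n")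
        (auto simp: g_def inj_eq[OF assms(2)] double_neq_Suc_double elim!: evenE oddE)
  qed
  moreover have "interleave (e \<circ> f) c = interleave e c \<circ> g" for e
    by (auto simp: fun_eq_iff g_def interleave_def)
  moreover have "range (e \<circ> f) \<subseteq> U" if "range e \<subseteq> U" for e
    using that by auto
  ultimately show ?thesis using 1 unfolding definable_def
    by (intro exI[of _ "rename_fm g \<phi>"] exI[of _ c]) (auto simp: sat_rename_fm)
qed

text \<open>Substitution is expressed by quantifying over two new variables that are equated with
  the terms.\<close>

lemma definable_subst2:
  assumes "definable U E (\<lambda>e. Q (e 0) (e 1))" "is_term U t" "is_term U s" "U \<noteq> {}"
  shows "definable U E (\<lambda>e. Q (t e) (s e))"
proof (rule definable_cong)
  \<comment> \<open>Under the two quantifiers the inner variable \<open>y\<close> has index 0 and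
    the outer \<open>x\<close> has index 1, so the arguments of \<open>Q\<close> are exchanged
    first.\<close>
  define f :: "nat \<Rightarrow> nat" where "f n = (if n = 0 then 1 else if n = 1 then 0 else n)" for n
  have "inj f" by (auto simp: f_def inj_on_def)
  from definable_reindex[OF assms(1) this] have "definable U E (\<lambda>e. Q (e 1) (e 0))"
    by (simp add: f_def)
  then show "definable U E (\<lambda>e. \<exists>x\<in>U. \<exists>y\<in>U. x = t e \<and> y = s e \<and> Q x y)"
    by (intro definable_ex definable_conj definable_eq is_term_var is_term_shift assms) simp
  show "Q (t e) (s e) \<longleftrightarrow> (\<exists>x\<in>U. \<exists>y\<in>U. x = t e \<and> y = s e \<and> Q x y)" if "range e \<subseteq> U" for e
    using that assms is_term_in by blast
qed

lemmas definable_intros =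
  is_term_var is_term_const definable_not definable_conj definable_disj definable_imp definable_iff
  definable_all definable_ex definable_ball definable_bex definable_eq definable_in_elts
  definable_is_pair definable_related

section \<open>Set theory inside a model\<close>

locale ZF =
  fixes U :: "'a set" and E :: "'a \<Rightarrow> 'a \<Rightarrow> bool"
  assumes ZF: "ZF_model U E"
begin

abbreviation el :: "'a \<Rightarrow> 'a set" where "el \<equiv> elts U E"
abbreviation rel :: "'a \<Rightarrow> 'a \<Rightarrow> 'a \<Rightarrow> bool" where "rel \<equiv> related U E"
abbreviation pr :: "'a \<Rightarrow> 'a \<Rightarrow> 'a \<Rightarrow> bool" where "pr \<equiv> is_pair U E"

lemma nonempty: "U \<noteq> {}"
  using ZF by (simp add: ZF_model_def)

lemma el_in: "x \<in> el y \<Longrightarrow> x \<in> U"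
  by (simp add: elts_def)

lemma extensionality: "x \<in> U \<Longrightarrow> y \<in> U \<Longrightarrow> el x = el y \<Longrightarrow> x = y"
  using ZF by (simp add: ZF_model_def)

lemma foundation: "x \<in> U \<Longrightarrow> y \<in> el x \<Longrightarrow> \<exists>y\<in>el x. el y \<inter> el x = {}"
  using ZF by (auto simp: ZF_model_def)

lemma upair_ex: "a \<in> U \<Longrightarrow> b \<in> U \<Longrightarrow> \<exists>c\<in>U. el c = {a, b}"
  using ZF by (simp add: ZF_model_def is_upair_def)

lemma Union_ex: "x \<in> U \<Longrightarrow> \<exists>u\<in>U. el u = (\<Union>y\<in>el x. el y)"
  using ZF by (auto simp: ZF_model_def)

lemma Pow_ex: "x \<in> U \<Longrightarrow> \<exists>p\<in>U. el p = {y\<in>U. el y \<subseteq> el x}"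
  using ZF by (auto simp: ZF_model_def)

lemma infinity: "\<exists>I\<in>U. inductive_set_in U E I"
  using ZF by (simp add: ZF_model_def)

lemma separation_schema: "Defs.separation U E" and replacement_schema: "Defs.replacement U E"
  using ZF by (simp_all add: ZF_model_def)

section \<open>Axiom schemata for definable predicates\<close>

lemma separation:
  assumes "a \<in> U" "definable U E (\<lambda>e. Q (e 0))"
  shows "\<exists>b\<in>U. el b = {z\<in>el a. Q z}"
proof -
  obtain \<phi> c where c: "range c \<subseteq> U"
    "\<And>e. range e \<subseteq> U \<Longrightarrow> Q (e 0) \<longleftrightarrow> sat U E (interleave e c) \<phi>"
    using assms unfolding definable_def by metis
  define e where "e = interleave (\<lambda>_. a) c"
  have e: "range e \<subseteq> U" unfolding e_def by (rule interleave_in) (use assms c in auto)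
  have "Q z \<longleftrightarrow> sat U E (e(0 := z)) \<phi>" if "z \<in> U" for z
  proof -
    have "interleave ((\<lambda>_. a)(0 := z)) c = e(0 := z)"
      by (auto simp: fun_eq_iff e_def interleave_def)
    moreover have "range ((\<lambda>_::nat. a)(0 := z)) \<subseteq> U" using that assms by auto
    ultimately show ?thesis using c(2)[of "(\<lambda>_. a)(0 := z)"] by simp
  qed
  then have "{z\<in>el a. Q z} = {z\<in>el a. sat U E (e(0 := z)) \<phi>}"
    using el_in by blast
  then show ?thesis
    using separation_schema e assms(1) unfolding separation_def by simp
qed

lemma replacement_total:
  assumes "a \<in> U" "definable U E (\<lambda>e. Q (e 0) (e 1))" "\<And>x. x \<in> el a \<Longrightarrow> \<exists>!y. y \<in> U \<and> Q x y"
  shows "\<exists>b\<in>U. el b = {y\<in>U. \<exists>x\<in>el a. Q x y}"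
proof -
  obtain \<phi> c where c: "range c \<subseteq> U"
    "\<And>e. range e \<subseteq> U \<Longrightarrow> Q (e 0) (e 1) \<longleftrightarrow> sat U E (interleave e c) \<phi>"
    using assms unfolding definable_def by metis
  \<comment> \<open>The axiom schema reads its two variables at indices 0 and 1, whereas
    \<open>interleave\<close> stores them at 0 and 2.\<close>
  define f :: "nat \<Rightarrow> nat" where "f n = (if n = 1 then 2 else if n = 2 then 1 else n)" for n
  have f: "inj f" "f (f n) = n" for n
    by (auto simp: f_def inj_on_def)
  define e where "e = interleave (\<lambda>_. a) c \<circ> f"
  have e: "range e \<subseteq> U"
    using interleave_in[of "\<lambda>_. a" U c] assms c unfolding e_def by auto
  have *: "Q x y \<longleftrightarrow> sat U E (e(0 := x, 1 := y)) (rename_fm f \<phi>)" if "x \<in> U" "y \<in> U" for x y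
  proof -
    have "interleave ((\<lambda>_. a)(0 := x, 1 := y)) c = e(0 := x, 1 := y) \<circ> f"
    proof
      fix n :: nat
      consider "n = 0" | "n = 1" | "n = 2" | "n \<ge> 3" by linarith
      then show "interleave ((\<lambda>_. a)(0 := x, 1 := y)) c n = (e(0 := x, 1 := y) \<circ> f) n"
      proof cases
        case 4
        then have "n div 2 \<noteq> 0" "even n \<Longrightarrow> n div 2 \<noteq> 1" by presburger+
        then show ?thesis using 4 by (auto simp: e_def f_def interleave_def div_eq_0_iff)
      qed (simp_all add: e_def f_def interleave_def)
    qed
    moreover have "range ((\<lambda>_::nat. a)(0 := x, 1 := y)) \<subseteq> U" using that assms by auto
    ultimately show ?thesis
      using c(2)[of "(\<lambda>_. a)(0 := x, 1 := y)"] by (simp add: sat_rename_fm f(1))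
  qed
  have "\<forall>x\<in>el a. \<exists>!y. y \<in> U \<and> sat U E (e(0 := x, 1 := y)) (rename_fm f \<phi>)"
    using assms(3) * el_in by blast
  then have "\<exists>b\<in>U. el b = {y\<in>U. \<exists>x\<in>el a. sat U E (e(0 := x, 1 := y)) (rename_fm f \<phi>)}"
    using replacement_schema e assms(1) unfolding replacement_def by blast
  moreover have "{y\<in>U. \<exists>x\<in>el a. sat U E (e(0 := x, 1 := y)) (rename_fm f \<phi>)} = {y\<in>U. \<exists>x\<in>el a. Q x y}"
    using * el_in by blast
  ultimately show ?thesis by simp
qed

text \<open>The axiom wants a value at every point of the domain, so \<open>a\<close> is first cut
  down by separation to the points where \<open>Q\<close> has one.\<close>

lemma replacement:
  assumes "a \<in> U" "definable U E (\<lambda>e. Q (e 0) (e 1))"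
    and "\<And>x y y'. x \<in> el a \<Longrightarrow> y \<in> U \<Longrightarrow> y' \<in> U \<Longrightarrow> Q x y \<Longrightarrow> Q x y' \<Longrightarrow> y = y'"
  shows "\<exists>b\<in>U. el b = {y\<in>U. \<exists>x\<in>el a. Q x y}"
proof -
  have "definable U E (\<lambda>e. \<exists>y\<in>U. Q (e 0) y)"
    by (intro definable_ex definable_subst2[OF assms(2)] is_term_var nonempty)
  then obtain a' where a': "a' \<in> U" "el a' = {x\<in>el a. \<exists>y\<in>U. Q x y}"
    using separation[of a "\<lambda>x. \<exists>y\<in>U. Q x y"] assms(1) by auto
  have "\<exists>!y. y \<in> U \<and> Q x y" if "x \<in> el a'" for x
    using that a' assms(3) by blast
  moreover have "{y\<in>U. \<exists>x\<in>el a'. Q x y} = {y\<in>U. \<exists>x\<in>el a. Q x y}"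
    using a'(2) by blast
  ultimately show ?thesis
    using replacement_total[OF a'(1) assms(2)] by simp
qed

section \<open>Elementary set operations, pairs and graphs\<close>

lemma empty_ex: "\<exists>z\<in>U. el z = {}"
proof -
  obtain a where "a \<in> U" using nonempty by blast
  then show ?thesis
    using separation[of a "\<lambda>_. False"] definable_const[OF nonempty] by auto
qed

lemma Un_ex:
  assumes "a \<in> U" "b \<in> U" shows "\<exists>c\<in>U. el c = el a \<union> el b"
proof -
  obtain d where "d \<in> U" "el d = {a, b}" using upair_ex assms by blast
  then show ?thesis using Union_ex[of d] by auto
qed

lemma insert_ex:
  assumes "a \<in> U" "b \<in> U" shows "\<exists>c\<in>U. el c = insert a (el b)"
proof -
  obtain d where "d \<in> U" "el d = {a, a}" using upair_ex assms by blast
  then show ?thesis using Un_ex[of d b] assms by auto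
qed

lemma Int_ex:
  assumes "a \<in> U" "b \<in> U" shows "\<exists>c\<in>U. el c = el a \<inter> el b"
proof -
  have "definable U E (\<lambda>e. e 0 \<in> el b)"
    by (intro definable_intros nonempty assms)
  from separation[OF assms(1), of "\<lambda>x. x \<in> el b", OF this] show ?thesis by auto
qed

lemma pr_iff: "pr c a b \<longleftrightarrow> (\<exists>s\<in>U. \<exists>d\<in>U. el s = {a} \<and> el d = {a, b} \<and> el c = {s, d})"
  by (simp add: is_pair_def is_upair_def)

lemma pr_ex: "a \<in> U \<Longrightarrow> b \<in> U \<Longrightarrow> \<exists>c\<in>U. pr c a b"
  unfolding pr_iff using upair_ex by (metis insert_absorb2)

lemma pr_components: "pr c a b \<Longrightarrow> a \<in> U \<and> b \<in> U"
  unfolding pr_iff using el_in by blast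

lemma pr_inj: "pr c a b \<Longrightarrow> pr c a' b' \<Longrightarrow> a = a' \<and> b = b'"
  unfolding pr_iff by (metis doubleton_eq_iff insert_absorb2)

lemma pr_unique: "c \<in> U \<Longrightarrow> c' \<in> U \<Longrightarrow> pr c a b \<Longrightarrow> pr c' a b \<Longrightarrow> c = c'"
  unfolding pr_iff using extensionality by metis

lemma rel_components: "rel r a b \<Longrightarrow> a \<in> U \<and> b \<in> U"
  unfolding related_def using pr_components by blast

lemma product_ex:
  assumes "A \<in> U" "B \<in> U"
  shows "\<exists>C\<in>U. el C = {c\<in>U. \<exists>a\<in>el A. \<exists>b\<in>el B. pr c a b}"
proof -
  obtain D where D: "D \<in> U" "el D = el A \<union> el B" using Un_ex assms by blast
  \<comment> \<open>A pair of elements of \<open>D\<close> consists of subsets of \<open>D\<close>,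
    hence lies in the double power set.\<close>
  obtain D1 where D1: "D1 \<in> U" "el D1 = {y\<in>U. el y \<subseteq> el D}" using Pow_ex D by blast
  obtain D2 where D2: "D2 \<in> U" "el D2 = {y\<in>U. el y \<subseteq> el D1}" using Pow_ex D1 by blast
  have "definable U E (\<lambda>e. \<exists>a\<in>el A. \<exists>b\<in>el B. pr (e 0) a b)"
    by (intro definable_intros nonempty assms)
  from separation[OF D2(1), of "\<lambda>c. \<exists>a\<in>el A. \<exists>b\<in>el B. pr c a b", OF this]
  obtain C where C: "C \<in> U" "el C = {c\<in>el D2. \<exists>a\<in>el A. \<exists>b\<in>el B. pr c a b}" by auto
  have "c \<in> el D2" if "c \<in> U" "a \<in> el A" "b \<in> el B" "pr c a b" for a b c
    using that unfolding pr_iff by (auto simp: D2 D1 D)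
  then have "el C = {c\<in>U. \<exists>a\<in>el A. \<exists>b\<in>el B. pr c a b}"
    using C el_in by blast
  then show ?thesis using C by blast
qed

text \<open>Replacement yields the pairs directly, so no codomain has to be given in advance. This
  matters for the forcing relation.\<close>

lemma graph_ex:
  assumes "A \<in> U" "definable U E (\<lambda>e. Q (e 0) (e 1))"
    and "\<And>x y y'. x \<in> el A \<Longrightarrow> y \<in> U \<Longrightarrow> y' \<in> U \<Longrightarrow> Q x y \<Longrightarrow> Q x y' \<Longrightarrow> y = y'"
  shows "\<exists>S\<in>U. el S = {c\<in>U. \<exists>x\<in>el A. \<exists>y\<in>U. pr c x y \<and> Q x y}"
proof -
  have "\<exists>S\<in>U. el S = {c\<in>U. \<exists>x\<in>el A. (\<exists>y\<in>U. pr c x y \<and> Q x y)}"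
  proof (rule replacement)
    show "definable U E (\<lambda>e. \<exists>y\<in>U. pr (e 1) (e 0) y \<and> Q (e 0) y)"
      by (intro definable_intros definable_subst2[OF assms(2)] nonempty)
  next
    fix x c c' assume "x \<in> el A" "c \<in> U" "c' \<in> U"
      "\<exists>y\<in>U. pr c x y \<and> Q x y" "\<exists>y\<in>U. pr c' x y \<and> Q x y"
    then show "c = c'" using assms(3) pr_unique by metis
  qed fact
  then show ?thesis .
qed

lemma rel_graph:
  assumes "el S = {c\<in>U. \<exists>x\<in>el A. \<exists>y\<in>U. pr c x y \<and> Q x y}"
  shows "rel S a b \<longleftrightarrow> a \<in> el A \<and> b \<in> U \<and> Q a b"
proof
  assume "rel S a b"
  then obtain c where "c \<in> el S" "pr c a b" unfolding related_def by blast
  then show "a \<in> el A \<and> b \<in> U \<and> Q a b" using assms pr_inj by blast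
next
  assume *: "a \<in> el A \<and> b \<in> U \<and> Q a b"
  then obtain c where "c \<in> U" "pr c a b" using pr_ex el_in by blast
  then have "c \<in> el S" using assms * by blast
  then show "rel S a b" using \<open>pr c a b\<close> unfolding related_def by blast
qed

lemma function_on_graph:
  assumes "el S = {c\<in>U. \<exists>x\<in>el A. \<exists>y\<in>U. pr c x y \<and> Q x y}" "\<And>x. x \<in> el A \<Longrightarrow> \<exists>!y. y \<in> U \<and> Q x y"
  shows "function_on U E S A"
  unfolding function_on_def rel_graph[OF assms(1)] using assms by auto

lemma rel_insert_ex:
  assumes "S \<in> U" "a \<in> U" "b \<in> U"
  shows "\<exists>S'\<in>U. \<forall>x y. rel S' x y \<longleftrightarrow> rel S x y \<or> (x = a \<and> y = b)"
proof -
  obtain c where c: "c \<in> U" "pr c a b" using pr_ex assms by blast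
  obtain S' where "S' \<in> U" "el S' = insert c (el S)" using insert_ex c assms by blast
  then show ?thesis using c pr_inj unfolding related_def by (intro bexI[of _ S']) auto
qed

section \<open>Induction on names\<close>

lemma name_closed_rel:
  assumes "name_closed U E P T" "\<pi> \<in> el T" "rel \<pi> \<rho> q"
  shows "\<rho> \<in> el T" "q \<in> el P"
proof -
  obtain c where "c \<in> el \<pi>" "pr c \<rho> q" using assms unfolding related_def by blast
  moreover then obtain \<rho>' q' where "\<rho>' \<in> el T" "q' \<in> el P" "pr c \<rho>' q'"
    using assms unfolding name_closed_def by blast
  ultimately show "\<rho> \<in> el T" "q \<in> el P" using pr_inj by blast+
qed

text \<open>\<open>E\<close> need not be well-founded from outside, so the predicate must be
  definable, and foundation is applied to a set built from the counterexamples.\<close>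

lemma name_induct [consumes 3, case_names definable step]:
  assumes "T \<in> U" "name_closed U E P T" "\<pi> \<in> el T" and "definable U E (\<lambda>e. Q (e 0))"
    and step: "\<And>\<pi>. \<pi> \<in> el T \<Longrightarrow> (\<And>\<rho> q. rel \<pi> \<rho> q \<Longrightarrow> \<rho> \<in> el T \<Longrightarrow> q \<in> el P \<Longrightarrow> Q \<rho>) \<Longrightarrow> Q \<pi>"
  shows "Q \<pi>"
proof (rule ccontr)
  assume "\<not> Q \<pi>"
  obtain N where N: "N \<in> U" "el N = {\<pi>\<in>el T. \<not> Q \<pi>}"
    using separation[OF assms(1) definable_not[OF assms(4)]] by blast
  txt \<open>
    A membership-minimal element of \<open>N\<close> need not be minimal for being a name occurring in a name.
    Adding the singletons and pairs in between repairs this.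
  \<close>
  obtain D1 where D1: "D1 \<in> U" "el D1 = {y\<in>U. el y \<subseteq> el N}" using Pow_ex N by blast
  have "definable U E (\<lambda>e. \<exists>x\<in>U. x \<in> el (e 0))"
    by (intro definable_intros nonempty)
  from separation[OF D1(1), of "\<lambda>y. \<exists>x\<in>U. x \<in> el y", OF this]
  obtain D2 where D2: "D2 \<in> U" "el D2 = {y\<in>U. el y \<subseteq> el N \<and> (\<exists>x\<in>U. x \<in> el y)}"
    unfolding D1(2) by auto
  obtain B where B: "B \<in> U" "el B = (\<Union>\<pi>\<in>el T. el \<pi>)" using Union_ex assms(1) by blast
  have "definable U E (\<lambda>e. \<exists>x\<in>el D2. x \<in> el (e 0))"
    by (intro definable_intros nonempty D2)
  from separation[OF B(1), of "\<lambda>y. \<exists>x\<in>el D2. x \<in> el y", OF this]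
  obtain D3 where D3: "D3 \<in> U" "el D3 = {y\<in>el B. \<exists>x\<in>el D2. x \<in> el y}" by auto
  obtain M0 where M0: "M0 \<in> U" "el M0 = el N \<union> el D2" using Un_ex N D2 by blast
  obtain M where M: "M \<in> U" "el M = el N \<union> el D2 \<union> el D3" using Un_ex M0 D3 by metis
  have "\<pi> \<in> el M" using M N assms(3) \<open>\<not> Q \<pi>\<close> by blast
  then obtain m where m: "m \<in> el M" "el m \<inter> el M = {}" using foundation M by blast
  \<comment> \<open>Members of \<open>D2\<close> contain an element of \<open>N\<close> and members
    of \<open>D3\<close> contain one of \<open>D2\<close>, so a minimal element of \<open>M\<close>
    can only come from \<open>N\<close>.\<close>
  then have "m \<notin> el D2" "m \<notin> el D3" using M D2 D3 by blast+
  then have "m \<in> el T" "\<not> Q m" using m M N by blast+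
  moreover have "Q \<rho>" if \<rho>: "rel m \<rho> q" "\<rho> \<in> el T" for \<rho> q
  proof (rule ccontr)
    assume "\<not> Q \<rho>"
    obtain c s where c: "c \<in> el m" "s \<in> el c" "el s = {\<rho>}"
      using \<rho> unfolding related_def pr_iff by blast
    then have "s \<in> el D2" using D2 N \<rho> \<open>\<not> Q \<rho>\<close> el_in by auto
    moreover have "c \<in> el B" using c B \<open>m \<in> el T\<close> by blast
    ultimately have "c \<in> el D3" using D3 c by blast
    then show False using M m c by blast
  qed
  ultimately show False using step by blast
qed

section \<open>Natural numbers and countability inside the model\<close>

definition succ_of :: "'a \<Rightarrow> 'a \<Rightarrow> bool" where
  "succ_of s n \<longleftrightarrow> el s = insert n (el n)"

lemma definable_succ_of:
  assumes "is_term U t" "is_term U s"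
  shows "definable U E (\<lambda>e. succ_of (t e) (s e))"
proof (rule definable_cong)
  show "definable U E (\<lambda>e. \<forall>x\<in>U. x \<in> el (t e) \<longleftrightarrow> x = s e \<or> x \<in> el (s e))"
    by (intro definable_intros is_term_shift assms nonempty)
  show "succ_of (t e) (s e) \<longleftrightarrow> (\<forall>x\<in>U. x \<in> el (t e) \<longleftrightarrow> x = s e \<or> x \<in> el (s e))"
    if "range e \<subseteq> U" for e
    using is_term_in[OF assms(2) that] by (auto simp: succ_of_def elts_def set_eq_iff)
qed

lemma no_two_cycle:
  assumes "m \<in> el n" "n \<in> el m" shows False
proof -
  obtain d where "d \<in> U" "el d = {m, n}" using upair_ex assms el_in by blast
  then show False using foundation[of d m] assms by auto
qed

lemma succ_of_inj:
  assumes "succ_of s m" "succ_of s n" shows "m = n"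
  using assms no_two_cycle[of m n] unfolding succ_of_def by (metis insert_iff)

text \<open>Separation turns \<open>Q\<close> into an inductive subset of \<open>w\<close>, and
  \<open>w\<close> is contained in every inductive set of the model.\<close>

lemma omega_induct [consumes 3, case_names definable zero succ]:
  assumes "w \<in> U" "is_omega U E w" "n \<in> el w" and Q: "definable U E (\<lambda>e. Q (e 0))"
    and zero: "\<And>n. n \<in> el w \<Longrightarrow> el n = {} \<Longrightarrow> Q n"
    and succ: "\<And>n s. n \<in> el w \<Longrightarrow> s \<in> el w \<Longrightarrow> succ_of s n \<Longrightarrow> Q n \<Longrightarrow> Q s"
  shows "Q n"
proof -
  obtain I where I: "I \<in> U" "el I = {n\<in>el w. Q n}"
    using separation[OF assms(1) Q] by blast
  have w: "inductive_set_in U E w" using assms(2) by (simp add: is_omega_def)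
  have "inductive_set_in U E I"
    unfolding inductive_set_in_def
  proof
    obtain z where "z \<in> el w" "el z = {}" using w unfolding inductive_set_in_def by blast
    then show "\<exists>z\<in>el I. el z = {}" using zero I(2) by blast
    show "\<forall>n\<in>el I. \<exists>s\<in>el I. el s = insert n (el n)"
    proof
      fix n assume n: "n \<in> el I"
      then obtain s where s: "s \<in> el w" "el s = insert n (el n)"
        using w I(2) unfolding inductive_set_in_def by blast
      then have "Q s" using succ[of n s] n I(2) by (simp add: succ_of_def)
      then show "\<exists>s\<in>el I. el s = insert n (el n)" using s I(2) by blast
    qed
  qed
  then have "el w \<subseteq> el I" using assms(2) I(1) by (simp add: is_omega_def)
  then show ?thesis using assms(3) I by blast
qed

context
  fixes w assumes w: "w \<in> U" "is_omega U E w"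
begin

lemma omega_zero_le:
  assumes "z \<in> el w" "el z = {}" "n \<in> el w" shows "z = n \<or> z \<in> el n"
  using w assms(3)
proof (induction rule: omega_induct)
  case definable
  show ?case by (intro definable_intros nonempty el_in[OF assms(1)])
next
  case (zero n)
  then show ?case using assms(1,2) extensionality[of z n] el_in by simp
qed (auto simp: succ_of_def)

lemma omega_succ_le:
  assumes "n \<in> el w" shows "\<forall>m\<in>el n. \<forall>s\<in>U. succ_of s m \<longrightarrow> s \<in> el n \<or> s = n"
  using w assms
proof (induction rule: omega_induct)
  case definable
  show ?case by (intro definable_intros definable_succ_of nonempty)
next
  case (succ n t)
  show ?case
  proof (intro ballI impI)
    fix m s assume m: "m \<in> el t" "s \<in> U" "succ_of s m"
    show "s \<in> el t \<or> s = t"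
    proof (cases "m = n")
      case True
      then have "el s = el t" using m succ by (simp add: succ_of_def)
      then show ?thesis using extensionality m(2) el_in[OF succ(2)] by blast
    qed (use m succ in \<open>auto simp: succ_of_def\<close>)
  qed
qed auto

text \<open>Serves to make membership-minimal elements of a subset of \<open>w\<close> unique. The
  successor step rests on \<open>omega_succ_le\<close>.\<close>

lemma omega_trichotomy:
  assumes "m \<in> el w" shows "\<forall>n\<in>el w. m \<in> el n \<or> m = n \<or> n \<in> el m"
  using w assms
proof (induction rule: omega_induct)
  case definable
  show ?case by (intro definable_intros nonempty w)
next
  case (zero m)
  then show ?case using omega_zero_le by blast
next
  case (succ m s)
  then show ?case using omega_succ_le el_in unfolding succ_of_def by blast
qed

end

text \<open>Each \<open>b\<close> is mapped to the least code in \<open>w\<close> of any of its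
  preimages, a definable selection. Equal codes come from one preimage, at which \<open>Q\<close> is
  functional, so the map is injective.\<close>

lemma countable_image:
  assumes A: "A \<in> U" "countable_in U E A" and B: "B \<in> U"
    and Q: "definable U E (\<lambda>e. Q (e 0) (e 1))"
    and onto: "\<And>b. b \<in> el B \<Longrightarrow> \<exists>a\<in>el A. Q a b"
    and functional: "\<And>a b b'. a \<in> el A \<Longrightarrow> b \<in> el B \<Longrightarrow> b' \<in> el B \<Longrightarrow> Q a b \<Longrightarrow> Q a b' \<Longrightarrow> b = b'"
  shows "countable_in U E B"
proof -
  obtain w h where w: "w \<in> U" "is_omega U E w" and h: "h \<in> U" "function_on U E h A"
    and hw: "\<And>u n. u \<in> el A \<Longrightarrow> n \<in> U \<Longrightarrow> rel h u n \<Longrightarrow> n \<in> el w"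
    and inj: "\<And>u v n. u \<in> el A \<Longrightarrow> v \<in> el A \<Longrightarrow> n \<in> U \<Longrightarrow> rel h u n \<Longrightarrow> rel h v n \<Longrightarrow> u = v"
    using A unfolding countable_in_def by blast
  define K where "K b n \<longleftrightarrow> (\<exists>a\<in>el A. Q a b \<and> rel h a n)" for b n
  define L where "L b n \<longleftrightarrow> K b n \<and> (\<forall>m\<in>el n. \<not> K b m)" for b n
  have K_def': "definable U E (\<lambda>e. K (t e) (s e))" if "is_term U t" "is_term U s" for t s
    unfolding K_def using that
    by (intro definable_intros definable_subst2[OF Q] is_term_shift nonempty A h)
  have L_def': "definable U E (\<lambda>e. L (e 0) (e 1))"
    unfolding L_def by (intro definable_intros K_def' nonempty)
  have Kw: "n \<in> el w" if "K b n" for b n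
    using that hw rel_components unfolding K_def by blast
  have L_ex: "\<exists>!n. n \<in> U \<and> L b n" if b: "b \<in> el B" for b
  proof -
    obtain a where a: "a \<in> el A" "Q a b" using onto b by blast
    then obtain n where n: "n \<in> U" "rel h a n" using h unfolding function_on_def by blast
    have "definable U E (\<lambda>e. K b (e 0))"
      using b el_in by (intro K_def' definable_intros)
    then obtain N where N: "N \<in> U" "el N = {n\<in>el w. K b n}"
      using separation[OF w(1)] by blast
    have "n \<in> el N" using N Kw a n unfolding K_def by blast
    then obtain m where "m \<in> el N" "el m \<inter> el N = {}" using foundation N by blast
    then have "m \<in> U \<and> L b m" unfolding L_def using N Kw el_in by blast
    moreover have "m = m'" if "L b m" "L b m'" for m m'
      using that omega_trichotomy[OF w] Kw unfolding L_def by blast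
    ultimately show ?thesis by blast
  qed
  obtain S where S: "S \<in> U" "el S = {c\<in>U. \<exists>x\<in>el B. \<exists>y\<in>U. pr c x y \<and> L x y}"
    using graph_ex[OF B L_def'] L_ex by blast
  note rel = rel_graph[OF S(2)]
  have "function_on U E S B"
    using function_on_graph[OF S(2)] L_ex by blast
  moreover have "n \<in> el w" if "rel S b n" for b n
    using that Kw unfolding rel L_def by blast
  moreover have "b = b'" if "rel S b n" "rel S b' n" for b b' n
    using that inj functional unfolding rel L_def K_def by (metis (no_types))
  ultimately show ?thesis using w S(1) unfolding countable_in_def by blast
qed

text \<open>Union is iterated along an inductive set, starting from the singleton of
  \<open>c\<close>, and the levels are collected by replacement. The recursion runs inside the model
  through set-sized approximations.\<close>

lemma transitive_superset:
  assumes "c \<in> U"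
  obtains C where "C \<in> U" "c \<in> el C" "\<And>x. x \<in> el C \<Longrightarrow> el x \<subseteq> el C"
proof -
  obtain c1 where c1: "c1 \<in> U" "el c1 = {c}" using upair_ex[OF assms assms] by auto
  obtain I where I: "I \<in> U" "inductive_set_in U E I"
    using infinity by blast
  define un where "un y z \<longleftrightarrow> el y = (\<Union>x\<in>el z. el x)" for y z
  have un_def': "definable U E (\<lambda>e. un (t e) (s e))" if "is_term U t" "is_term U s" for t s
  proof (rule definable_cong)
    show "definable U E (\<lambda>e. \<forall>x\<in>U. x \<in> el (t e) \<longleftrightarrow> (\<exists>y\<in>el (s e). x \<in> el y))"
      by (intro definable_intros is_term_shift that nonempty)
    show "un (t e) (s e) \<longleftrightarrow> (\<forall>x\<in>U. x \<in> el (t e) \<longleftrightarrow> (\<exists>y\<in>el (s e). x \<in> el y))"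
      if "range e \<subseteq> U" for e
      unfolding un_def using el_in by blast
  qed
  txt \<open>\<open>good S\<close>: every pair \<open>(m, y)\<close> in \<open>S\<close> is justified, so that \<open>y\<close> is the \<open>m\<close>-fold union of \<open>c1\<close>.\<close>
  define good where "good S \<longleftrightarrow> (\<forall>m\<in>U. \<forall>y\<in>U. rel S m y \<longrightarrow>
    (\<forall>k\<in>U. k \<notin> el m) \<and> y = c1 \<or> (\<exists>k\<in>U. \<exists>z\<in>U. rel S k z \<and> succ_of m k \<and> un y z))" for S
  define lev where "lev n y \<longleftrightarrow> (\<exists>S\<in>U. good S \<and> rel S n y)" for n y
  have lev_def': "definable U E (\<lambda>e. lev (t e) (s e))" if "is_term U t" "is_term U s" for t s
    unfolding lev_def good_def using that
    by (intro definable_intros un_def' definable_succ_of is_term_shift nonempty c1)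
  have lev_zero: "lev n c1" if n: "n \<in> U" "el n = {}" for n
  proof -
    obtain e0 where e0: "e0 \<in> U" "el e0 = {}" using empty_ex by blast
    obtain S where S: "S \<in> U" "\<And>x y. rel S x y \<longleftrightarrow> rel e0 x y \<or> (x = n \<and> y = c1)"
      using rel_insert_ex[OF e0(1) n(1) c1(1)] by blast
    have "\<not> rel e0 x y" for x y using e0 by (simp add: related_def)
    then have "good S" using that(2) unfolding good_def S(2) by simp
    then show ?thesis using S unfolding lev_def by blast
  qed
  have lev_succ: "lev s y" if n: "lev n z" "s \<in> U" "y \<in> U" "succ_of s n" "un y z" for n z s y
  proof -
    obtain S where S: "S \<in> U" "good S" "rel S n z" using n(1) unfolding lev_def by blast
    obtain S' where S': "S' \<in> U" "\<And>a b. rel S' a b \<longleftrightarrow> rel S a b \<or> (a = s \<and> b = y)"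
      using rel_insert_ex[OF S(1) n(2,3)] by blast
    have nz: "n \<in> U" "z \<in> U" using rel_components[OF S(3)] by auto
    have "good S'"
      unfolding good_def
    proof (intro ballI impI)
      fix m v assume mv: "m \<in> U" "v \<in> U" "rel S' m v"
      show "(\<forall>k\<in>U. k \<notin> el m) \<and> v = c1 \<or> (\<exists>k\<in>U. \<exists>z\<in>U. rel S' k z \<and> succ_of m k \<and> un v z)"
      proof (cases "m = s \<and> v = y")
        case True
        then show ?thesis using S(3) S'(2) nz that(4,5) by blast
      next
        case False
        then have "rel S m v" using mv S'(2) by blast
        then show ?thesis using S(2) mv(1,2) S'(2) unfolding good_def by meson
      qed
    qed
    then show ?thesis using S' unfolding lev_def by blast
  qed
  have lev_zeroD: "y = c1" if n: "lev n y" "el n = {}" for n y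
  proof -
    obtain S where S: "good S" "rel S n y" using n(1) unfolding lev_def by blast
    have "\<not> succ_of n k" for k using that by (simp add: succ_of_def)
    then show ?thesis using S rel_components[OF S(2)] unfolding good_def by blast
  qed
  have lev_succD: "\<exists>z\<in>U. lev n z \<and> un y z" if s: "lev s y" "succ_of s n" for n s y
  proof -
    obtain S where S: "S \<in> U" "good S" "rel S s y" using s(1) unfolding lev_def by blast
    have "n \<in> el s" using that by (simp add: succ_of_def)
    then have "\<exists>k\<in>U. \<exists>z\<in>U. rel S k z \<and> succ_of s k \<and> un y z"
      using S(2,3) rel_components[OF S(3)] el_in unfolding good_def by blast
    then show ?thesis using S(1,2) succ_of_inj[OF _ that(2)] unfolding lev_def by metis
  qed
  \<comment> \<open>\<open>I\<close> is any inductive set and may have more elements than the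
    natural numbers of the model. Keeping only indices with exactly one level makes replacement
    applicable; these contain zero and are closed under successor in \<open>I\<close>.\<close>
  have "definable U E (\<lambda>e. \<exists>y\<in>U. lev (e 0) y \<and> (\<forall>y'\<in>U. lev (e 0) y' \<longrightarrow> y' = y))"
    by (intro definable_intros lev_def' nonempty)
  from separation[OF I(1), of "\<lambda>n. \<exists>y\<in>U. lev n y \<and> (\<forall>y'\<in>U. lev n y' \<longrightarrow> y' = y)", OF this]
  obtain J where J: "J \<in> U" "el J = {n\<in>el I. \<exists>y\<in>U. lev n y \<and> (\<forall>y'\<in>U. lev n y' \<longrightarrow> y' = y)}"
    by auto
  have "definable U E (\<lambda>e. lev (e 0) (e 1))"
    by (intro lev_def' definable_intros)
  moreover have J_unique: "y = y'" if y: "n \<in> el J" "y \<in> U" "y' \<in> U" "lev n y" "lev n y'" for n y y'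
  proof -
    obtain y0 where "\<forall>y'\<in>U. lev n y' \<longrightarrow> y' = y0" using y(1) unfolding J(2) by blast
    then show ?thesis using y(2-5) by metis
  qed
  ultimately obtain Y where Y: "Y \<in> U" "el Y = {y\<in>U. \<exists>n\<in>el J. lev n y}"
    using replacement[OF J(1), of lev] by blast
  obtain C where C: "C \<in> U" "el C = (\<Union>y\<in>el Y. el y)" using Union_ex[OF Y(1)] by blast
  obtain z where z: "z \<in> el I" "el z = {}" using I(2) unfolding inductive_set_in_def by blast
  have "z \<in> el J" using z(1) J(2) lev_zero[OF el_in z(2)] lev_zeroD[OF _ z(2)] c1(1) by blast
  then have "c1 \<in> el Y" using Y(2) lev_zero[OF el_in z(2)] c1(1) z(1) by blast
  then have "c \<in> el C" using C c1 by auto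
  moreover have "el x \<subseteq> el C" if x: "x \<in> el C" for x
  proof -
    \<comment> \<open>The elements of an element of level \<open>n\<close> lie in the next level, so
      what remains is that the successor \<open>s\<close> of \<open>n\<close> belongs to
      \<open>J\<close>.\<close>
    obtain y n where y: "x \<in> el y" "y \<in> U" "n \<in> el J" "lev n y" using x C(2) Y(2) by blast
    obtain u where u: "u \<in> U" "un u y" using Union_ex[OF y(2)] unfolding un_def by blast
    obtain s where s: "s \<in> el I" "succ_of s n"
      using y(3) J(2) I(2) unfolding inductive_set_in_def succ_of_def by blast
    have "lev s u" using lev_succ[OF y(4) el_in[OF s(1)] u(1) s(2) u(2)] .
    moreover have "u' = u" if u': "u' \<in> U" "lev s u'" for u'
    proof -
      obtain y' where "y' \<in> U" "lev n y'" "un u' y'" using lev_succD u'(2) s(2) by blast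
      moreover then have "y' = y" using y(2,3,4) J_unique by blast
      ultimately show ?thesis using u u'(1) extensionality unfolding un_def by simp
    qed
    ultimately have "s \<in> el J" using s(1) u(1) J(2) by blast
    then have "u \<in> el Y" using Y(2) u(1) \<open>lev s u\<close> by blast
    then show ?thesis using C(2) y(1) u(2) unfolding un_def by blast
  qed
  ultimately show thesis using that C(1) by blast
qed

end

section \<open>Forcing a name to denote a ground model set\<close>

text \<open>Recursion on names is confined to a fixed set \<open>T\<close>, so that the forcing
  relation can be a set of the model.\<close>

locale forcing_names = ZF +
  fixes P le T :: 'a
  assumes forcing: "forcing_notion U E P le"
    and T: "T \<in> U" "name_closed U E P T"
begin

abbreviation ext :: "'a \<Rightarrow> 'a \<Rightarrow> bool" (infix "\<preceq>" 50) where "p \<preceq> q \<equiv> rel le p q"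

lemma P_in: "P \<in> U" and le_in: "le \<in> U"
  using forcing by (auto simp: forcing_notion_def)

lemma ext_refl: "p \<in> el P \<Longrightarrow> p \<preceq> p"
  using forcing by (simp add: forcing_notion_def)

lemma ext_P:
  assumes "p \<preceq> q" shows "p \<in> el P" "q \<in> el P"
proof -
  obtain c where "c \<in> el le" "pr c p q" using assms unfolding related_def by blast
  moreover then obtain p' q' where "p' \<in> el P" "q' \<in> el P" "pr c p' q'"
    using forcing unfolding forcing_notion_def by blast
  ultimately show "p \<in> el P" "q \<in> el P" using pr_inj by blast+
qed

lemma ext_trans: "p \<preceq> q \<Longrightarrow> q \<preceq> r \<Longrightarrow> p \<preceq> r"
  using forcing ext_P unfolding forcing_notion_def by blast

section \<open>The forcing relation as a greatest fixed point\<close>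

definition tri :: "'a \<Rightarrow> 'a \<Rightarrow> 'a \<Rightarrow> 'a \<Rightarrow> bool" where
  "tri S p \<pi> c \<longleftrightarrow> (\<exists>a\<in>U. pr a p \<pi> \<and> rel S a c)"

lemma tri_components: "tri S p \<pi> c \<Longrightarrow> p \<in> U \<and> \<pi> \<in> U \<and> c \<in> U"
  unfolding tri_def using rel_components pr_components by blast

lemma definable_tri:
  assumes "is_term U t" "is_term U s" "is_term U r" "is_term U q"
  shows "definable U E (\<lambda>e. tri (t e) (s e) (r e) (q e))"
  unfolding tri_def by (intro definable_intros is_term_shift assms nonempty)

text \<open>
  The recursion equation for \<open>p\<close> forcing the name \<open>\<pi>\<close> to denote the ground model set \<open>c\<close>, where
  \<open>K s \<rho> d\<close> stands for this relation at the names \<open>\<rho>\<close> occurring in \<open>\<pi>\<close>.  Since \<open>K\<close> occurs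
  only positively, the relation can be obtained as a greatest fixed point.
\<close>

definition forces_step :: "('a \<Rightarrow> 'a \<Rightarrow> 'a \<Rightarrow> bool) \<Rightarrow> 'a \<Rightarrow> 'a \<Rightarrow> 'a \<Rightarrow> bool" where
  "forces_step K p \<pi> c \<longleftrightarrow>
     (\<forall>\<rho>\<in>U. \<forall>q\<in>U. rel \<pi> \<rho> q \<longrightarrow> (\<forall>r\<in>U. r \<preceq> p \<and> r \<preceq> q \<longrightarrow>
        (\<exists>s\<in>U. s \<preceq> r \<and> (\<exists>d\<in>el c. K s \<rho> d)))) \<and>
     (\<forall>d\<in>el c. \<forall>r\<in>U. r \<preceq> p \<longrightarrow>
        (\<exists>s\<in>U. s \<preceq> r \<and> (\<exists>\<rho>\<in>U. \<exists>q\<in>U. rel \<pi> \<rho> q \<and> s \<preceq> q \<and> K s \<rho> d)))"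

lemma forces_step_mono:
  assumes "forces_step K p \<pi> c"
    and "\<And>s \<rho> q d. rel \<pi> \<rho> q \<Longrightarrow> s \<in> el P \<Longrightarrow> d \<in> el c \<Longrightarrow> K s \<rho> d \<Longrightarrow> K' s \<rho> d"
  shows "forces_step K' p \<pi> c"
  using assms ext_P unfolding forces_step_def by meson

lemma forces_step_ext:
  assumes "forces_step K p \<pi> c" "p' \<preceq> p"
  shows "forces_step K p' \<pi> c"
  using assms ext_trans unfolding forces_step_def by meson

lemma definable_forces_step:
  assumes "is_term U t" "is_term U s" "is_term U r" "is_term U q"
  shows "definable U E (\<lambda>e. forces_step (tri (t e)) (s e) (r e) (q e))"
  unfolding forces_step_def
  by (intro definable_intros definable_tri is_term_shift assms nonempty le_in)

text \<open>These are the post-fixed points of \<open>forces_step\<close> over \<open>P\<close> and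
  \<open>T\<close>; their union will be the greatest fixed point.\<close>

definition justified :: "'a \<Rightarrow> bool" where
  "justified S \<longleftrightarrow> (\<forall>p\<in>el P. \<forall>\<pi>\<in>el T. \<forall>c\<in>U. tri S p \<pi> c \<longrightarrow> forces_step (tri S) p \<pi> c)"

text \<open>Induction on names. An element \<open>d\<close> of \<open>c\<close> is assigned below
  \<open>r\<close> to some name occurring in \<open>\<pi>\<close>; further below, the same name is
  assigned an element of \<open>c'\<close>, and by the induction hypothesis the two agree.\<close>

lemma justified_unique:
  assumes S: "S \<in> U" "justified S" and S': "S' \<in> U" "justified S'"
    and "\<pi> \<in> el T" "tri S p \<pi> c" "tri S' p' \<pi> c'" "r \<preceq> p" "r \<preceq> p'"
  shows "c = c'"
proof -
  \<comment> \<open>Stated for arbitrary \<open>S\<close> and \<open>S'\<close>, so that exchanging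
    them yields the reverse inclusion.\<close>
  have half: "el c \<subseteq> el c'"
    if S: "justified S" and S': "justified S'" and \<pi>: "\<pi> \<in> el T" "tri S p \<pi> c" "tri S' p' \<pi> c'"
      and r: "r \<preceq> p" "r \<preceq> p'"
      and IH: "\<And>\<rho> q p p' r d d'. rel \<pi> \<rho> q \<Longrightarrow> tri S p \<rho> d \<Longrightarrow> tri S' p' \<rho> d' \<Longrightarrow>
        r \<preceq> p \<Longrightarrow> r \<preceq> p' \<Longrightarrow> d = d'"
    for S S' \<pi> p p' c c' r
  proof
    fix d assume d: "d \<in> el c"
    have "forces_step (tri S) p \<pi> c" "forces_step (tri S') p' \<pi> c'"
      using S S' \<pi> r ext_P tri_components unfolding justified_def by blast+
    note steps = this[unfolded forces_step_def]
    obtain s \<rho> q where s: "s \<preceq> r" "rel \<pi> \<rho> q" "s \<preceq> q" "tri S s \<rho> d"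
      using steps(1) d r rel_components by meson
    then obtain s' d' where s': "s' \<preceq> s" "d' \<in> el c'" "tri S' s' \<rho> d'"
      using steps(2) r ext_trans rel_components by meson
    then have "d = d'" using IH s s' ext_refl ext_P by blast
    then show "d \<in> el c'" using s' by simp
  qed
  have "\<forall>p\<in>U. \<forall>p'\<in>U. \<forall>r\<in>U. \<forall>c\<in>U. \<forall>c'\<in>U.
    tri S p \<pi> c \<and> tri S' p' \<pi> c' \<and> r \<preceq> p \<and> r \<preceq> p' \<longrightarrow> c = c'"
    using T \<open>\<pi> \<in> el T\<close>
  proof (induction rule: name_induct)
    case definable
    show ?case by (intro definable_intros definable_tri nonempty le_in S S')
  next
    case (step \<pi>)
    have IH: "d = d'" if "rel \<pi> \<rho> q" "tri S p \<rho> d" "tri S' p' \<rho> d'" "r \<preceq> p" "r \<preceq> p'"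
      for \<rho> q p p' r d d'
      using step(2)[OF that(1) name_closed_rel[OF T(2) step(1) that(1)]] that
        tri_components rel_components by meson
    have IH': "d = d'" if "rel \<pi> \<rho> q" "tri S' p \<rho> d" "tri S p' \<rho> d'" "r \<preceq> p" "r \<preceq> p'"
      for \<rho> q p p' r d d'
      using IH[OF that(1,3,2,5,4)] by simp
    show ?case
    proof (intro ballI impI)
      fix p p' r c c' assume *: "c \<in> U" "c' \<in> U"
        "tri S p \<pi> c \<and> tri S' p' \<pi> c' \<and> r \<preceq> p \<and> r \<preceq> p'"
      then have **: "tri S p \<pi> c" "tri S' p' \<pi> c'" "r \<preceq> p" "r \<preceq> p'" by auto
      have "el c \<subseteq> el c'" by (rule half[OF S(2) S'(2) step(1) **]) (rule IH)
      moreover have "el c' \<subseteq> el c" by (rule half[OF S'(2) S(2) step(1) **(2,1,4,3)]) (rule IH')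
      ultimately show "c = c'" using extensionality[OF *(1,2)] by blast
    qed
  qed
  then show ?thesis using assms tri_components rel_components by meson
qed

text \<open>Knaster-Tarski argument: the union of the justified sets is justified by monotonicity,
  and adding a triple that satisfies the recursion clause keeps it justified, so the triple was
  already there.\<close>

lemma forces_relation_ex:
  "\<exists>R\<in>U. \<forall>p\<in>el P. \<forall>\<pi>\<in>el T. \<forall>c\<in>U. tri R p \<pi> c \<longleftrightarrow> forces_step (tri R) p \<pi> c"
proof -
  define F where "F p \<pi> c \<longleftrightarrow> (\<exists>S\<in>U. justified S \<and> tri S p \<pi> c)" for p \<pi> c
  obtain A where A: "A \<in> U" "el A = {a\<in>U. \<exists>p\<in>el P. \<exists>\<pi>\<in>el T. pr a p \<pi>}"
    using product_ex P_in T by blast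
  define Q where "Q a c \<longleftrightarrow> (\<exists>p\<in>el P. \<exists>\<pi>\<in>el T. pr a p \<pi> \<and> F p \<pi> c)" for a c
  have Q_def': "definable U E (\<lambda>e. Q (e 0) (e 1))"
    unfolding Q_def F_def justified_def
    by (intro definable_intros definable_tri definable_forces_step nonempty P_in T)
  \<comment> \<open>Two justified sets never assign different values to the same pair, so their
    union is a set by replacement although \<open>c\<close> ranges over the whole model.\<close>
  have "c = c'" if "Q a c" "Q a c'" for a c c'
    using that pr_inj justified_unique ext_refl unfolding Q_def F_def by (metis (no_types, lifting))
  then obtain R where R: "R \<in> U" "el R = {x\<in>U. \<exists>a\<in>el A. \<exists>c\<in>U. pr x a c \<and> Q a c}"
    using graph_ex[OF A(1) Q_def'] by blast
  have tri_R: "tri R p \<pi> c \<longleftrightarrow> p \<in> el P \<and> \<pi> \<in> el T \<and> c \<in> U \<and> F p \<pi> c" for p \<pi> c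
    using pr_ex el_in pr_inj unfolding tri_def rel_graph[OF R(2)] A Q_def by blast
  have "justified R"
    unfolding justified_def
  proof (intro ballI impI)
    fix p \<pi> c assume *: "p \<in> el P" "\<pi> \<in> el T" "c \<in> U" "tri R p \<pi> c"
    then obtain S where S: "S \<in> U" "justified S" "tri S p \<pi> c" unfolding tri_R F_def by blast
    then have "forces_step (tri S) p \<pi> c" using * unfolding justified_def by blast
    then show "forces_step (tri R) p \<pi> c"
    proof (rule forces_step_mono)
      fix s \<rho> q d assume "rel \<pi> \<rho> q" "s \<in> el P" "d \<in> el c" "tri S s \<rho> d"
      then show "tri R s \<rho> d"
        unfolding tri_R F_def using S * name_closed_rel[OF T(2)] el_in by blast
    qed
  qed
  moreover have "tri R p \<pi> c"
    if *: "p \<in> el P" "\<pi> \<in> el T" "c \<in> U" "forces_step (tri R) p \<pi> c" for p \<pi> c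
  proof -
    obtain a where a: "a \<in> U" "pr a p \<pi>" using pr_ex * el_in by blast
    obtain S where S: "S \<in> U" "\<And>x y. rel S x y \<longleftrightarrow> rel R x y \<or> (x = a \<and> y = c)"
      using rel_insert_ex R(1) a * by metis
    have tri_S: "tri S p' \<pi>' c' \<longleftrightarrow> tri R p' \<pi>' c' \<or> (p' = p \<and> \<pi>' = \<pi> \<and> c' = c)" for p' \<pi>' c'
      unfolding tri_def S using a pr_inj by blast
    have "justified S"
      unfolding justified_def
    proof (intro ballI impI)
      fix p' \<pi>' c' assume "p' \<in> el P" "\<pi>' \<in> el T" "c' \<in> U" "tri S p' \<pi>' c'"
      then have "forces_step (tri R) p' \<pi>' c'"
        using * \<open>justified R\<close> unfolding tri_S justified_def by blast
      then show "forces_step (tri S) p' \<pi>' c'"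
        by (rule forces_step_mono) (simp add: tri_S)
    qed
    then show ?thesis using S tri_S * unfolding tri_R F_def by blast
  qed
  ultimately show ?thesis using R(1) unfolding justified_def by blast
qed

end

section \<open>Names and their values in the extension\<close>

text \<open>\<open>T\<close> is a name-closed set of the ground model and \<open>T'\<close> the
  domain in \<open>W\<close> of the evaluation \<open>h\<close>; neither is assumed to contain the
  other. \<open>R\<close> is a set solution of the forcing recursion.\<close>

locale generic_evaluation = V: forcing_names V E P le T + W: ZF W E
  for V W :: "'a set" and E and P le T :: 'a +
  fixes G :: "'a set" and \<Gamma> T' h R :: 'a
  assumes VW: "V \<subseteq> W" "\<And>x. x \<in> V \<Longrightarrow> elts W E x \<subseteq> V"
    and generic: "generic_filter V E P le G"
    and \<Gamma>: "\<Gamma> \<in> W" "elts W E \<Gamma> = G"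
    and T': "T' \<in> W" "name_closed W E P T'"
    and h: "h \<in> W" "function_on W E h T'"
    and h_rec: "\<And>\<tau> v. \<tau> \<in> elts W E T' \<Longrightarrow> v \<in> W \<Longrightarrow> related W E h \<tau> v \<Longrightarrow>
      elts W E v = {z\<in>W. \<exists>\<pi>\<in>elts W E T'. \<exists>p\<in>elts W E \<Gamma>. related W E \<tau> \<pi> p \<and> related W E h \<pi> z}"
    and R: "R \<in> V"
    and R_fix: "\<And>p \<pi> c. p \<in> elts V E P \<Longrightarrow> \<pi> \<in> elts V E T \<Longrightarrow> c \<in> V \<Longrightarrow>
      V.tri R p \<pi> c \<longleftrightarrow> V.forces_step (V.tri R) p \<pi> c"
begin

notation V.ext (infix "\<preceq>" 50)

abbreviation forces :: "'a \<Rightarrow> 'a \<Rightarrow> 'a \<Rightarrow> bool" where "forces \<equiv> V.tri R"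

section \<open>Absoluteness between ground model and extension\<close>

lemma elts_abs: "x \<in> V \<Longrightarrow> elts W E x = elts V E x"
  using VW unfolding elts_def by blast

lemma pair_abs:
  assumes "c \<in> V" shows "W.pr c a b \<longleftrightarrow> V.pr c a b"
proof
  assume "W.pr c a b"
  then obtain s d where *: "s \<in> W" "d \<in> W" "W.el s = {a}" "W.el d = {a, b}" "W.el c = {s, d}"
    unfolding W.pr_iff by blast
  then have "s \<in> V" "d \<in> V" using VW(2)[OF assms] by auto
  with * show "V.pr c a b" unfolding V.pr_iff using elts_abs assms by auto
next
  assume "V.pr c a b"
  then show "W.pr c a b"
    unfolding V.pr_iff W.pr_iff using elts_abs assms VW(1) by (metis subsetD)
qed

lemma rel_abs: "r \<in> V \<Longrightarrow> W.rel r a b \<longleftrightarrow> V.rel r a b"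
  unfolding related_def using elts_abs pair_abs V.el_in by metis

text \<open>Expresses forcing through a parameter of \<open>W\<close>, so that inductions inside
  \<open>W\<close> may speak about it even if \<open>V\<close> is not definable there.\<close>

lemma forces_abs: "forces p \<pi> c \<longleftrightarrow> (\<exists>a\<in>W. W.pr a p \<pi> \<and> W.rel R a c)"
  unfolding V.tri_def rel_abs[OF R] using pair_abs V.rel_components VW(1) by blast

lemma definable_forces_W:
  assumes "is_term W t" "is_term W s" "is_term W r"
  shows "definable W E (\<lambda>e. forces (t e) (s e) (r e))"
  unfolding forces_abs using R VW(1)
  by (intro definable_intros is_term_shift assms W.nonempty) auto

section \<open>Genericity\<close>

lemma G_P: "p \<in> G \<Longrightarrow> p \<in> V.el P"
  using generic by (auto simp: generic_filter_def)

lemma G_up: "p \<in> G \<Longrightarrow> p \<preceq> q \<Longrightarrow> q \<in> G"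
  using generic V.ext_P(2)[of p q] by (simp add: generic_filter_def)

lemma G_directed: "p \<in> G \<Longrightarrow> q \<in> G \<Longrightarrow> \<exists>r\<in>G. r \<preceq> p \<and> r \<preceq> q"
  using generic by (simp add: generic_filter_def)

lemma G_meets:
  assumes "definable V E (\<lambda>e. X (e 0))" "\<And>p. p \<in> V.el P \<Longrightarrow> \<exists>s. s \<preceq> p \<and> X s"
  shows "\<exists>s\<in>G. X s"
proof -
  obtain D where D: "D \<in> V" "V.el D = {s\<in>V.el P. X s}"
    using V.separation[OF V.P_in assms(1)] by blast
  have "dense V E P le D"
    unfolding dense_def D(2) using assms(2) V.ext_P(1) by blast
  then have "G \<inter> V.el D \<noteq> {}" using generic D(1) by (simp add: generic_filter_def)
  then show ?thesis using D(2) by blast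
qed

lemma G_meets_below:
  assumes X: "definable V E (\<lambda>e. X (e 0))" and r: "r \<in> G"
    and below: "\<And>r'. r' \<preceq> r \<Longrightarrow> \<exists>s. s \<preceq> r' \<and> X s"
  shows "\<exists>s\<in>G. X s"
proof -
  \<comment> \<open>Adding the conditions incompatible with \<open>r\<close> turns density below
    \<open>r\<close> into density. No member of \<open>G\<close> is of the added kind, since
    \<open>G\<close> is directed.\<close>
  define Y where "Y s \<longleftrightarrow> X s \<or> \<not> (\<exists>t\<in>V. t \<preceq> s \<and> t \<preceq> r)" for s
  have "definable V E (\<lambda>e. Y (e 0))"
    unfolding Y_def
    by (intro definable_intros X V.nonempty V.le_in V.el_in[OF G_P[OF r]])
  moreover have "\<exists>s. s \<preceq> p \<and> Y s" if "p \<in> V.el P" for p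
  proof (cases "Y p")
    case False
    then obtain t where t: "t \<preceq> p" "t \<preceq> r" unfolding Y_def by blast
    then obtain s where "s \<preceq> t" "X s" using below by blast
    then show ?thesis using t V.ext_trans unfolding Y_def by blast
  qed (use V.ext_refl that in blast)
  ultimately obtain s where s: "s \<in> G" "Y s" using G_meets[of Y] by blast
  then show ?thesis using G_directed[OF s(1) r] V.rel_components unfolding Y_def by blast
qed

section \<open>Truth lemma for ground model values\<close>

lemma forces_ext:
  assumes "forces p \<pi> c" "p' \<preceq> p" "\<pi> \<in> V.el T" shows "forces p' \<pi> c"
  using assms R_fix V.ext_P V.forces_step_ext V.tri_components by meson

lemma h_mem:
  assumes "\<tau> \<in> W.el T'" "W.rel h \<tau> v"
  shows "z \<in> W.el v \<longleftrightarrow> (\<exists>\<pi> p. p \<in> G \<and> W.rel \<tau> \<pi> p \<and> W.rel h \<pi> z)"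
proof -
  have "v \<in> W" using W.rel_components assms by blast
  then show ?thesis
    using h_rec[OF assms(1) _ assms(2)] \<Gamma>(2) W.name_closed_rel(1)[OF T'(2) assms(1)] W.rel_components
    by blast
qed

lemma h_ex: "\<tau> \<in> W.el T' \<Longrightarrow> \<exists>v\<in>W. W.rel h \<tau> v"
  using h(2) unfolding function_on_def by blast

lemma h_unique: "\<tau> \<in> W.el T' \<Longrightarrow> W.rel h \<tau> v \<Longrightarrow> W.rel h \<tau> v' \<Longrightarrow> v = v'"
  using h(2) W.rel_components unfolding function_on_def by blast

text \<open>On this intersection both the forcing relation and the evaluation are available, and
  being name-closed in \<open>W\<close> it supports induction on names there.\<close>

lemma common_names:
  obtains N where "N \<in> W" "W.el N = V.el T \<inter> W.el T'" "name_closed W E P N"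
proof -
  obtain N where N: "N \<in> W" "W.el N = V.el T \<inter> W.el T'"
    using W.Int_ex[of T T'] V.T(1) VW(1) T'(1) elts_abs by auto
  have "name_closed W E P N"
    unfolding name_closed_def
  proof (intro ballI)
    fix \<tau> c assume *: "\<tau> \<in> W.el N" "c \<in> W.el \<tau>"
    then obtain \<pi> p where p: "\<pi> \<in> W.el T'" "p \<in> W.el P" "W.pr c \<pi> p"
      using N T'(2) unfolding name_closed_def by blast
    have \<tau>: "\<tau> \<in> V" "\<tau> \<in> V.el T" using * N V.el_in by blast+
    then have "V.rel \<tau> \<pi> p"
      using * p rel_abs unfolding related_def by blast
    then have "\<pi> \<in> V.el T" using V.name_closed_rel(1)[OF V.T(2)] \<tau> by blast
    then show "\<exists>\<pi>\<in>W.el N. \<exists>p\<in>W.el P. W.pr c \<pi> p" using p N by blast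
  qed
  then show thesis using that N by blast
qed

text \<open>Induction on names in \<open>W\<close> compares the actual value \<open>v\<close> of
  \<open>\<pi>\<close> with \<open>c\<close>: the first clause of \<open>forces_step\<close> puts
  \<open>v\<close> inside \<open>c\<close>, the second gives the converse.\<close>

lemma forces_sound:
  assumes "\<pi> \<in> V.el T" "\<pi> \<in> W.el T'" "p \<in> G" "forces p \<pi> c"
  shows "W.rel h \<pi> c"
proof -
  obtain N where N: "N \<in> W" "W.el N = V.el T \<inter> W.el T'" "name_closed W E P N"
    using common_names by blast
  have "\<pi> \<in> W.el N" using assms N by blast
  with N(1,3) have "\<forall>p\<in>W.el \<Gamma>. \<forall>c\<in>W. forces p \<pi> c \<longrightarrow> W.rel h \<pi> c"
  proof (induction rule: W.name_induct)
    case definable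
    show ?case by (intro definable_intros definable_forces_W W.nonempty \<Gamma> h)
  next
    case (step \<pi>)
    have \<pi>: "\<pi> \<in> V.el T" "\<pi> \<in> W.el T'" "\<pi> \<in> V" using step(1) N V.el_in by blast+
    have IH: "W.rel h \<rho> d" if "V.rel \<pi> \<rho> q" "s \<in> G" "forces s \<rho> d" for \<rho> q s d
    proof -
      have r: "W.rel \<pi> \<rho> q" using rel_abs \<pi> that by blast
      have "d \<in> W" using that V.tri_components VW(1) by blast
      then show ?thesis
        using step(2)[OF r W.name_closed_rel[OF N(3) step(1) r]] that \<Gamma>(2) by blast
    qed
    show ?case
    proof (intro ballI impI)
      fix p c assume pc: "p \<in> W.el \<Gamma>" "c \<in> W" "forces p \<pi> c"
      then have p: "p \<in> G" "p \<in> V.el P" "c \<in> V" using \<Gamma> G_P V.tri_components by blast+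
      then have "V.forces_step forces p \<pi> c" using R_fix \<pi> pc by blast
      note step1 = conjunct1[OF this[unfolded V.forces_step_def]]
        and step2 = conjunct2[OF this[unfolded V.forces_step_def]]
      obtain v where v: "v \<in> W" "W.rel h \<pi> v" using h_ex \<pi> by blast
      have "W.el v = W.el c"
      proof
        show "W.el v \<subseteq> W.el c"
        proof
          fix z assume "z \<in> W.el v"
          then obtain \<rho> q where \<rho>: "q \<in> G" "W.rel \<pi> \<rho> q" "W.rel h \<rho> z" using h_mem \<pi> v by blast
          then have \<rho>': "V.rel \<pi> \<rho> q" using rel_abs \<pi> by blast
          obtain r where r: "r \<in> G" "r \<preceq> p" "r \<preceq> q" using G_directed p \<rho> by blast
          \<comment> \<open>By the first clause such conditions are dense below \<open>r\<close>.
            One of them in \<open>G\<close> identifies \<open>z\<close>, the value of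
            \<open>\<rho>\<close>, with an element of \<open>c\<close>.\<close>
          have "\<exists>s\<in>G. \<exists>d\<in>V.el c. forces s \<rho> d"
          proof (rule G_meets_below[OF _ r(1)])
            show "definable V E (\<lambda>e. \<exists>d\<in>V.el c. forces (e 0) \<rho> d)"
              using V.rel_components[OF \<rho>'] p R
              by (intro definable_intros V.definable_tri V.nonempty) auto
            fix r' assume "r' \<preceq> r"
            then have "r' \<preceq> p" "r' \<preceq> q" using r V.ext_trans by blast+
            then show "\<exists>s. s \<preceq> r' \<and> (\<exists>d\<in>V.el c. forces s \<rho> d)"
              using step1 V.rel_components \<rho>' by blast
          qed
          then obtain s d where "s \<in> G" "d \<in> V.el c" "forces s \<rho> d" by blast
          moreover then have "W.rel h \<rho> d" using IH \<rho>' by blast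
          moreover have "\<rho> \<in> W.el T'" using W.name_closed_rel(1)[OF T'(2) \<pi>(2) \<rho>(2)] .
          ultimately show "z \<in> W.el c" using h_unique \<rho>(3) elts_abs[OF p(3)] by blast
        qed
        show "W.el c \<subseteq> W.el v"
        proof
          fix d assume "d \<in> W.el c"
          then have d: "d \<in> V.el c" using elts_abs p by blast
          have "\<exists>s\<in>G. \<exists>\<rho>\<in>V. \<exists>q\<in>V. V.rel \<pi> \<rho> q \<and> s \<preceq> q \<and> forces s \<rho> d"
          proof (rule G_meets_below[OF _ p(1)])
            show "definable V E (\<lambda>e. \<exists>\<rho>\<in>V. \<exists>q\<in>V. V.rel \<pi> \<rho> q \<and> e 0 \<preceq> q \<and> forces (e 0) \<rho> d)"
              by (intro definable_intros V.definable_tri V.nonempty V.le_in \<pi> R V.el_in[OF d])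
            fix r' assume "r' \<preceq> p"
            then show "\<exists>s. s \<preceq> r' \<and> (\<exists>\<rho>\<in>V. \<exists>q\<in>V. V.rel \<pi> \<rho> q \<and> s \<preceq> q \<and> forces s \<rho> d)"
              using step2 V.rel_components d by blast
          qed
          then obtain s \<rho> q where "s \<in> G" "V.rel \<pi> \<rho> q" "s \<preceq> q" "forces s \<rho> d" by blast
          moreover then have "q \<in> G" "W.rel h \<rho> d" "W.rel \<pi> \<rho> q"
            using G_up IH rel_abs \<pi> by blast+
          ultimately show "d \<in> W.el v" using h_mem[OF \<pi>(2) v(2)] by blast
        qed
      qed
      then have "v = c" using W.extensionality v pc by blast
      then show "W.rel h \<pi> c" using v by simp
    qed
  qed
  moreover have "c \<in> W" using assms V.tri_components VW(1) by blast
  ultimately show ?thesis using assms \<Gamma> by blast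
qed

text \<open>\<open>G\<close> contains a condition that satisfies \<open>forces_step\<close> or
  refutes one of its two clauses, and a refutation would contradict that \<open>\<pi>\<close> has
  value \<open>c\<close>.\<close>

lemma forces_complete:
  assumes "\<pi> \<in> V.el T" "\<pi> \<in> W.el T'" "W.rel h \<pi> c" "c \<in> V"
  shows "\<exists>p\<in>G. forces p \<pi> c"
proof -
  obtain N where N: "N \<in> W" "W.el N = V.el T \<inter> W.el T'" "name_closed W E P N"
    using common_names by blast
  txt \<open>
    The induction takes place in \<open>W\<close>, where \<open>V\<close> need not be definable; a transitive set
    of \<open>V\<close> serves to restrict the values to \<open>V\<close>.
  \<close>
  obtain C where C: "C \<in> V" "c \<in> V.el C" "\<And>x. x \<in> V.el C \<Longrightarrow> V.el x \<subseteq> V.el C"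
    using V.transitive_superset[OF assms(4)] by blast
  have C_W: "C \<in> W" "W.el C = V.el C" using C VW(1) elts_abs by auto
  have "\<pi> \<in> W.el N" using assms N by blast
  with N(1,3) have "\<forall>c\<in>W.el C. W.rel h \<pi> c \<longrightarrow> (\<exists>p\<in>W.el \<Gamma>. forces p \<pi> c)"
  proof (induction rule: W.name_induct)
    case definable
    show ?case by (intro definable_intros definable_forces_W W.nonempty \<Gamma> h C_W)
  next
    case (step \<pi>)
    have \<pi>: "\<pi> \<in> V.el T" "\<pi> \<in> W.el T'" "\<pi> \<in> V" using step(1) N V.el_in by blast+
    have IH: "\<exists>p\<in>G. forces p \<rho> d" if "W.rel \<pi> \<rho> q" "W.rel h \<rho> d" "d \<in> V.el C" for \<rho> q d
      using step(2)[OF that(1) W.name_closed_rel[OF N(3) step(1) that(1)]] that \<Gamma>(2) C_W by blast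
    show ?case
    proof (intro ballI impI)
      fix c assume "c \<in> W.el C" and hc: "W.rel h \<pi> c"
      then have c: "c \<in> V.el C" "c \<in> V" using C_W V.el_in by blast+
      \<comment> \<open>\<open>X1\<close> refutes the first clause: some name active at
        \<open>p\<close> is never forced below \<open>p\<close> to denote an element of
        \<open>c\<close>. \<open>X2\<close> refutes the second: some element of \<open>c\<close> is
        never forced below \<open>p\<close> to be the value of an active name in
        \<open>\<pi>\<close>.\<close>
      define X1 where "X1 p \<longleftrightarrow> (\<exists>\<rho>\<in>V. \<exists>q\<in>V. V.rel \<pi> \<rho> q \<and> p \<preceq> q \<and>
        (\<forall>s\<in>V. s \<preceq> p \<longrightarrow> (\<forall>d\<in>V.el c. \<not> forces s \<rho> d)))" for p
      define X2 where "X2 p \<longleftrightarrow> (\<exists>d\<in>V.el c. \<forall>s\<in>V. s \<preceq> p \<longrightarrow>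
        (\<forall>\<rho>\<in>V. \<forall>q\<in>V. V.rel \<pi> \<rho> q \<and> s \<preceq> q \<longrightarrow> \<not> forces s \<rho> d))" for p
      have "\<exists>p\<in>G. V.forces_step forces p \<pi> c \<or> X1 p \<or> X2 p"
      proof (rule G_meets)
        show "definable V E (\<lambda>e. V.forces_step forces (e 0) \<pi> c \<or> X1 (e 0) \<or> X2 (e 0))"
          unfolding X1_def X2_def
          by (intro definable_intros V.definable_tri V.definable_forces_step V.nonempty V.le_in \<pi> R c)
        fix p assume p: "p \<in> V.el P"
        show "\<exists>s. s \<preceq> p \<and> (V.forces_step forces s \<pi> c \<or> X1 s \<or> X2 s)"
        proof (cases "V.forces_step forces p \<pi> c")
          case True
          then show ?thesis using V.ext_refl p by blast
        next
          case False
          then consider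
            \<rho> q r where "\<rho> \<in> V" "q \<in> V" "V.rel \<pi> \<rho> q" "r \<preceq> p" "r \<preceq> q"
              "\<forall>s\<in>V. s \<preceq> r \<longrightarrow> (\<forall>d\<in>V.el c. \<not> forces s \<rho> d)"
            | d r where "d \<in> V.el c" "r \<preceq> p"
              "\<forall>s\<in>V. s \<preceq> r \<longrightarrow> (\<forall>\<rho>\<in>V. \<forall>q\<in>V. V.rel \<pi> \<rho> q \<and> s \<preceq> q \<longrightarrow> \<not> forces s \<rho> d)"
            unfolding V.forces_step_def by meson
          then show ?thesis
          proof cases
            case 1
            then have "X1 r" unfolding X1_def by blast
            then show ?thesis using 1 by blast
          next
            case 2
            then have "X2 r" unfolding X2_def by blast
            then show ?thesis using 2 by blast
          qed
        qed
      qed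
      then obtain p where p: "p \<in> G" "V.forces_step forces p \<pi> c \<or> X1 p \<or> X2 p" by blast
      have "\<not> X1 p"
      proof
        assume "X1 p"
        then obtain \<rho> q where \<rho>: "V.rel \<pi> \<rho> q" "p \<preceq> q"
          and no: "\<forall>s\<in>V. s \<preceq> p \<longrightarrow> (\<forall>d\<in>V.el c. \<not> forces s \<rho> d)" unfolding X1_def by blast
        have \<rho>W: "W.rel \<pi> \<rho> q" "\<rho> \<in> V.el T"
          using \<rho> rel_abs \<pi> V.name_closed_rel[OF V.T(2)] by blast+
        then have "\<rho> \<in> W.el T'" using W.name_closed_rel[OF T'(2) \<pi>(2)] by blast
        \<comment> \<open>The value of \<open>\<rho>\<close> lies in \<open>c\<close>, and by
          induction a condition in \<open>G\<close> forces it; a common extension with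
          \<open>p\<close> is then excluded by \<open>X1\<close>.\<close>
        then obtain d where d: "W.rel h \<rho> d" using h_ex by blast
        then have "d \<in> W.el c" using h_mem[OF \<pi>(2) hc] \<rho>W G_up[OF p(1) \<rho>(2)] by blast
        then have dc: "d \<in> V.el c" "d \<in> V.el C" using elts_abs c C(3) by blast+
        then obtain p' where p': "p' \<in> G" "forces p' \<rho> d" using IH \<rho>W d by blast
        obtain s where "s \<in> G" "s \<preceq> p" "s \<preceq> p'" using G_directed p p' by blast
        then have "forces s \<rho> d" using forces_ext p' \<rho>W by blast
        then show False using no dc \<open>s \<preceq> p\<close> V.rel_components by blast
      qed
      moreover have "\<not> X2 p"
      proof
        assume "X2 p"
        then obtain d where d: "d \<in> V.el c" and
          no: "\<forall>s\<in>V. s \<preceq> p \<longrightarrow> (\<forall>\<rho>\<in>V. \<forall>q\<in>V. V.rel \<pi> \<rho> q \<and> s \<preceq> q \<longrightarrow> \<not> forces s \<rho> d)"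
          unfolding X2_def by blast
        then have "d \<in> W.el c" "d \<in> V.el C" using elts_abs c C(3) by blast+
        then obtain \<rho> q where \<rho>: "q \<in> G" "W.rel \<pi> \<rho> q" "W.rel h \<rho> d"
          using h_mem[OF \<pi>(2) hc] by blast
        then obtain p' where p': "p' \<in> G" "forces p' \<rho> d" using IH \<open>d \<in> V.el C\<close> by blast
        have \<rho>V: "V.rel \<pi> \<rho> q" using \<rho> rel_abs \<pi> by blast
        then have "\<rho> \<in> V.el T" using V.name_closed_rel[OF V.T(2)] \<pi> by blast
        obtain s' where s': "s' \<in> G" "s' \<preceq> p" "s' \<preceq> p'" using G_directed p p' by blast
        \<comment> \<open>A second extension step is taken because \<open>X2\<close> only speaks of
          conditions below \<open>q\<close>.\<close>
        obtain s where s: "s \<in> G" "s \<preceq> s'" "s \<preceq> q" using G_directed s' \<rho> by blast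
        then have "s \<preceq> p" "s \<preceq> p'" using s' V.ext_trans by blast+
        moreover then have "forces s \<rho> d" using forces_ext p' \<open>\<rho> \<in> V.el T\<close> by blast
        ultimately show False using no s \<rho>V V.rel_components by blast
      qed
      ultimately have "forces p \<pi> c" using p R_fix G_P \<pi> c by blast
      then show "\<exists>p\<in>W.el \<Gamma>. forces p \<pi> c" using p \<Gamma> by blast
    qed
  qed
  then show ?thesis using assms C C_W \<Gamma> by blast
qed

section \<open>Conditions deciding values of the function\<close>

definition decides :: "'a \<Rightarrow> 'a \<Rightarrow> 'a \<Rightarrow> 'a \<Rightarrow> bool" where
  "decides \<sigma> u p y \<longleftrightarrow>
     (\<exists>\<pi>\<in>V. \<exists>q\<in>V. \<exists>c\<in>V. V.rel \<sigma> \<pi> q \<and> p \<preceq> q \<and> V.pr c u y \<and> forces p \<pi> c)"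

text \<open>
  The second conjunct makes it unnecessary to work below a condition forcing \<open>\<sigma>\<close> to be a function.
\<close>

definition decides_uniquely :: "'a \<Rightarrow> 'a \<Rightarrow> 'a \<Rightarrow> 'a \<Rightarrow> bool" where
  "decides_uniquely \<sigma> u p y \<longleftrightarrow>
     decides \<sigma> u p y \<and> (\<forall>q\<in>V. \<forall>y'\<in>V. q \<preceq> p \<and> decides \<sigma> u q y' \<longrightarrow> y' = y)"

lemma definable_decides:
  assumes "is_term V t" "is_term V s" "is_term V r" "is_term V q"
  shows "definable V E (\<lambda>e. decides (t e) (s e) (r e) (q e))"
  unfolding decides_def
  by (intro definable_intros V.definable_tri is_term_shift assms V.nonempty V.le_in R)

lemma definable_decides_uniquely:
  assumes "is_term V t" "is_term V s" "is_term V r" "is_term V q"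
  shows "definable V E (\<lambda>e. decides_uniquely (t e) (s e) (r e) (q e))"
  unfolding decides_uniquely_def
  by (intro definable_intros definable_decides is_term_shift assms V.nonempty V.le_in)

lemma decides_components: "decides \<sigma> u p y \<Longrightarrow> p \<in> V.el P \<and> y \<in> V"
  unfolding decides_def using V.ext_P(1) V.pr_components by blast

text \<open>The witnessing name persists: \<open>decides\<close> asks for one fixed element of
  \<open>\<sigma>\<close>, not for witnesses at densely many extensions.\<close>

lemma decides_ext:
  assumes "\<sigma> \<in> V.el T" "decides \<sigma> u p y" "p' \<preceq> p"
  shows "decides \<sigma> u p' y"
proof -
  obtain \<pi> q c where *: "\<pi> \<in> V" "q \<in> V" "c \<in> V" "V.rel \<sigma> \<pi> q" "p \<preceq> q" "V.pr c u y" "forces p \<pi> c"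
    using assms(2) unfolding decides_def by blast
  then have "\<pi> \<in> V.el T" using V.name_closed_rel(1)[OF V.T(2) assms(1)] by blast
  then have "forces p' \<pi> c" using forces_ext * assms(3) by blast
  moreover have "p' \<preceq> q" using V.ext_trans * assms(3) by blast
  ultimately show ?thesis using * unfolding decides_def by blast
qed

lemma decides_uniquely_ext:
  assumes "\<sigma> \<in> V.el T" "decides_uniquely \<sigma> u p y" "p' \<preceq> p"
  shows "decides_uniquely \<sigma> u p' y"
  using assms decides_ext[OF assms(1)] V.ext_trans[OF _ assms(3)] unfolding decides_uniquely_def
  by blast

text \<open>The condition \<open>r\<close> inherits the decision for \<open>y\<close>, while below
  \<open>p'\<close> only \<open>y'\<close> can be decided. The case of equal conditions makes the
  relation functional.\<close>

lemma decides_uniquely_unique: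
  assumes "\<sigma> \<in> V.el T" "decides_uniquely \<sigma> u p y" "decides_uniquely \<sigma> u p' y'"
    and "r \<preceq> p" "r \<preceq> p'"
  shows "y = y'"
proof -
  have "decides \<sigma> u r y" using decides_ext assms unfolding decides_uniquely_def by blast
  moreover have "r \<in> V" using V.rel_components assms by blast
  ultimately show ?thesis
    using assms(3,5) decides_components unfolding decides_uniquely_def by blast
qed

lemma decides_sound:
  assumes "\<sigma> \<in> V.el T" "\<sigma> \<in> W.el T'" "W.rel h \<sigma> f" "p \<in> G" "decides \<sigma> u p y"
  shows "W.rel f u y"
proof -
  obtain \<pi> q c where *: "c \<in> V" "V.rel \<sigma> \<pi> q" "p \<preceq> q" "V.pr c u y" "forces p \<pi> c"
    using assms(5) unfolding decides_def by blast
  have \<sigma>: "W.rel \<sigma> \<pi> q" using rel_abs V.el_in[OF assms(1)] * by blast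
  have "\<pi> \<in> V.el T" "\<pi> \<in> W.el T'"
    using V.name_closed_rel(1)[OF V.T(2) assms(1)] * W.name_closed_rel(1)[OF T'(2) assms(2) \<sigma>]
    by blast+
  then have "W.rel h \<pi> c" using forces_sound assms(4) * by blast
  moreover have "q \<in> G" using G_up assms(4) * by blast
  ultimately have "c \<in> W.el f" using h_mem[OF assms(2,3)] \<sigma> by blast
  then show ?thesis using pair_abs * unfolding related_def by blast
qed

lemma decides_complete:
  assumes "\<sigma> \<in> V.el T" "\<sigma> \<in> W.el T'" "W.rel h \<sigma> f" "u \<in> V" "y \<in> V" "W.rel f u y"
  shows "\<exists>p\<in>G. decides \<sigma> u p y"
proof -
  obtain c where c: "c \<in> V" "V.pr c u y" using V.pr_ex assms by blast
  obtain c' where c': "c' \<in> W.el f" "W.pr c' u y" using assms(6) unfolding related_def by blast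
  \<comment> \<open>The pair found in \<open>f\<close> is the ground model pair, so the name
    denoting it has its value in \<open>V\<close>, as \<open>forces_complete\<close>
    requires.\<close>
  have "W.pr c u y" "c \<in> W" using c pair_abs VW(1) by blast+
  then have "c' = c" using W.pr_unique c' W.el_in by blast
  then obtain \<pi> q where \<pi>: "q \<in> G" "W.rel \<sigma> \<pi> q" "W.rel h \<pi> c"
    using c' h_mem[OF assms(2,3)] by blast
  have \<sigma>: "V.rel \<sigma> \<pi> q" using rel_abs V.el_in[OF assms(1)] \<pi> by blast
  have \<pi>T: "\<pi> \<in> V.el T" "\<pi> \<in> W.el T'"
    using V.name_closed_rel(1)[OF V.T(2) assms(1) \<sigma>] W.name_closed_rel(1)[OF T'(2) assms(2) \<pi>(2)]
    by blast+
  then obtain p where p: "p \<in> G" "forces p \<pi> c" using forces_complete \<pi> c by blast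
  obtain r where r: "r \<in> G" "r \<preceq> p" "r \<preceq> q" using G_directed p \<pi> by blast
  then have "forces r \<pi> c" using forces_ext p \<pi>T by blast
  then have "decides \<sigma> u r y" unfolding decides_def using \<sigma> r c V.rel_components by blast
  then show ?thesis using r by blast
qed

text \<open>Conditions deciding a value other than \<open>y\<close>, together with those having no
  such extension, are dense. \<open>G\<close> contains none of the first kind by soundness, so one
  of the second kind can be joined with a condition deciding \<open>y\<close>.\<close>

lemma decides_uniquely_complete:
  assumes \<sigma>: "\<sigma> \<in> V.el T" "\<sigma> \<in> W.el T'" "W.rel h \<sigma> f" and uy: "u \<in> V" "y \<in> V" "W.rel f u y"
    and functional: "\<And>y'. W.rel f u y' \<Longrightarrow> y' = y"
  shows "\<exists>p\<in>G. decides_uniquely \<sigma> u p y"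
proof -
  obtain p0 where p0: "p0 \<in> G" "decides \<sigma> u p0 y" using decides_complete assms by blast
  define X1 where "X1 q \<longleftrightarrow> (\<exists>y'\<in>V. y' \<noteq> y \<and> decides \<sigma> u q y')" for q
  define X2 where "X2 q \<longleftrightarrow> (\<forall>r\<in>V. \<forall>y'\<in>V. r \<preceq> q \<and> decides \<sigma> u r y' \<longrightarrow> y' = y)" for q
  have "\<exists>q\<in>G. X1 q \<or> X2 q"
  proof (rule G_meets)
    show "definable V E (\<lambda>e. X1 (e 0) \<or> X2 (e 0))"
      unfolding X1_def X2_def
      by (intro definable_intros definable_decides V.nonempty V.le_in V.el_in[OF \<sigma>(1)] uy)
    show "\<exists>s. s \<preceq> p \<and> (X1 s \<or> X2 s)" if "p \<in> V.el P" for p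
      using V.ext_refl[OF that] unfolding X1_def X2_def by blast
  qed
  then obtain q where q: "q \<in> G" "X1 q \<or> X2 q" by blast
  have "\<not> X1 q" using decides_sound[OF \<sigma> q(1)] functional unfolding X1_def by blast
  with q have "X2 q" by blast
  obtain r where r: "r \<in> G" "r \<preceq> p0" "r \<preceq> q" using G_directed p0 q by blast
  have "decides \<sigma> u r y" using decides_ext \<sigma> p0 r by blast
  moreover have "y' = y" if "s \<in> V" "y' \<in> V" "s \<preceq> r" "decides \<sigma> u s y'" for s y'
    using \<open>X2 q\<close> that V.ext_trans[OF that(3) r(3)] unfolding X2_def by blast
  ultimately show ?thesis using r unfolding decides_uniquely_def by blast
qed

section \<open>Countably many possible values and the covering function\<close>

lemma possible_values:
  assumes CCC3: "CCC3 V E P le" and \<sigma>: "\<sigma> \<in> V.el T" and u: "u \<in> V"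
  shows "\<exists>Y\<in>V. V.el Y = {y\<in>V. \<exists>p\<in>V.el P. decides_uniquely \<sigma> u p y} \<and> countable_in V E Y"
proof -
  note \<sigma>V = V.el_in[OF \<sigma>]
  have definable: "definable V E (\<lambda>e. decides_uniquely \<sigma> u (e 0) (e 1))"
    by (intro definable_decides_uniquely definable_intros \<sigma>V u)
  obtain Y where Y: "Y \<in> V" "V.el Y = {y\<in>V. \<exists>p\<in>V.el P. decides_uniquely \<sigma> u p y}"
    using V.replacement[OF V.P_in definable] decides_uniquely_unique[OF \<sigma>] V.ext_refl by blast
  \<comment> \<open>The second alternative makes the set \<open>D\<close> dense: a condition without
    an extension of the first kind belongs to \<open>D\<close> itself.\<close>
  have "definable V E (\<lambda>e. (\<exists>y\<in>V. decides_uniquely \<sigma> u (e 0) y) \<or>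
      (\<forall>q\<in>V. \<forall>y\<in>V. q \<preceq> e 0 \<longrightarrow> \<not> decides_uniquely \<sigma> u q y))"
    by (intro definable_intros definable_decides_uniquely V.nonempty V.le_in \<sigma>V u)
  from V.separation[OF V.P_in, of "\<lambda>p. (\<exists>y\<in>V. decides_uniquely \<sigma> u p y) \<or>
      (\<forall>q\<in>V. \<forall>y\<in>V. q \<preceq> p \<longrightarrow> \<not> decides_uniquely \<sigma> u q y)", OF this]
  obtain D where D: "D \<in> V" "V.el D = {p\<in>V.el P. (\<exists>y\<in>V. decides_uniquely \<sigma> u p y) \<or>
      (\<forall>q\<in>V. \<forall>y\<in>V. q \<preceq> p \<longrightarrow> \<not> decides_uniquely \<sigma> u q y)}"
    by blast
  have "predense V E P le D"
    unfolding predense_def compatible_def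
  proof (intro conjI ballI)
    fix p assume p: "p \<in> V.el P"
    have "\<exists>d\<in>V.el D. d \<preceq> p"
    proof (cases "\<exists>q y. q \<preceq> p \<and> y \<in> V \<and> decides_uniquely \<sigma> u q y")
      case True
      then show ?thesis unfolding D(2) using V.ext_P(1) by blast
    next
      case False
      then show ?thesis unfolding D(2) using p V.ext_refl by blast
    qed
    then obtain d where "d \<in> V.el D" "d \<preceq> p" by blast
    moreover then have "d \<in> V.el P" using D(2) by blast
    ultimately show "\<exists>d\<in>V.el D. \<exists>r\<in>V.el P. r \<preceq> p \<and> r \<preceq> d" using V.ext_refl by blast
  qed (use D(2) in blast)
  then obtain A where A: "A \<in> V" "V.el A \<subseteq> V.el D" "countable_in V E A" "predense V E P le A"
    using CCC3 D(1) unfolding CCC3_def by blast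
  have "countable_in V E Y"
  proof (rule V.countable_image[OF A(1,3) Y(1) definable])
    fix y assume "y \<in> V.el Y"
    then obtain p where p: "y \<in> V" "p \<in> V.el P" "decides_uniquely \<sigma> u p y" using Y(2) by blast
    then obtain a r where a: "a \<in> V.el A" "r \<in> V.el P" "r \<preceq> p" "r \<preceq> a"
      using A(4) unfolding predense_def compatible_def by blast
    have r: "decides_uniquely \<sigma> u r y" using decides_uniquely_ext \<sigma> p a by blast
    have "a \<in> V.el D" using a A(2) by blast
    \<comment> \<open>The common extension \<open>r\<close> uniquely decides a value, so
      \<open>a\<close> cannot satisfy the second alternative in \<open>D\<close> and must decide a
      value itself.\<close>
    then obtain y' where "y' \<in> V" "decides_uniquely \<sigma> u a y'"
      unfolding D(2) using r a p V.el_in by blast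
    moreover then have "y = y'" using decides_uniquely_unique[OF \<sigma> p(3)] a by blast
    ultimately show "\<exists>a\<in>V.el A. decides_uniquely \<sigma> u a y" using a by blast
  next
    fix a y y' assume "a \<in> V.el A" "decides_uniquely \<sigma> u a y" "decides_uniquely \<sigma> u a y'"
    moreover then have "a \<in> V.el P" using A(2) D(2) by blast
    ultimately show "y = y'" using decides_uniquely_unique[OF \<sigma>] V.ext_refl by blast
  qed
  then show ?thesis using Y by blast
qed

text \<open>The set of possible values is determined by \<open>u\<close>, so the graph of
  \<open>g\<close> exists by replacement in \<open>V\<close>. Countability is asserted pointwise, so
  no simultaneous choice of enumerations is involved.\<close>

lemma countable_cover:
  assumes CCC3: "CCC3 V E P le" and \<sigma>: "\<sigma> \<in> V.el T" "\<sigma> \<in> W.el T'" "W.rel h \<sigma> f"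
    and x: "x \<in> V" and f: "function_on W E f x" "\<And>u y. u \<in> W.el x \<Longrightarrow> W.rel f u y \<Longrightarrow> y \<in> V"
  shows "\<exists>g\<in>V. function_on V E g x \<and> (\<forall>u\<in>V.el x. \<exists>c\<in>V. V.rel g u c \<and> countable_in V E c \<and>
    (\<exists>y\<in>W. W.rel f u y \<and> y \<in> W.el c))"
proof -
  define Q where "Q u Y \<longleftrightarrow> (\<forall>y\<in>V. y \<in> V.el Y \<longleftrightarrow> (\<exists>p\<in>V.el P. decides_uniquely \<sigma> u p y))" for u Y
  have Q_iff: "Q u Y \<longleftrightarrow> V.el Y = {y\<in>V. \<exists>p\<in>V.el P. decides_uniquely \<sigma> u p y}" for u Y
    unfolding Q_def using V.el_in by blast
  have Q_ex: "\<exists>Y\<in>V. Q u Y \<and> countable_in V E Y" if "u \<in> V.el x" for u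
    unfolding Q_iff using possible_values[OF CCC3 \<sigma>(1) V.el_in[OF that]] by blast
  have Q_unique: "Y = Y'" if "Y \<in> V" "Y' \<in> V" "Q u Y" "Q u Y'" for u Y Y'
    using that V.extensionality unfolding Q_iff by simp
  have "definable V E (\<lambda>e. Q (e 0) (e 1))"
    unfolding Q_def
    by (intro definable_intros definable_decides_uniquely V.nonempty V.P_in V.el_in[OF \<sigma>(1)])
  then obtain g where g: "g \<in> V" "V.el g = {c\<in>V. \<exists>u\<in>V.el x. \<exists>Y\<in>V. V.pr c u Y \<and> Q u Y}"
    using V.graph_ex[OF x, of Q] Q_unique by blast
  have "function_on V E g x"
    using V.function_on_graph[OF g(2)] Q_ex Q_unique by blast
  moreover have "\<exists>c\<in>V. V.rel g u c \<and> countable_in V E c \<and> (\<exists>y\<in>W. W.rel f u y \<and> y \<in> W.el c)"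
    if u: "u \<in> V.el x" for u
  proof -
    obtain Y where Y: "Y \<in> V" "Q u Y" "countable_in V E Y" using Q_ex u by blast
    have uW: "u \<in> W.el x" using u elts_abs[OF x] by blast
    then have "\<exists>!y. y \<in> W \<and> W.rel f u y" using f(1) by (simp add: function_on_def)
    then obtain y where y: "y \<in> W" "W.rel f u y" "\<And>y'. W.rel f u y' \<Longrightarrow> y' = y"
      using W.rel_components by blast
    have yV: "y \<in> V" using f(2) uW y by blast
    obtain p where "p \<in> G" "decides_uniquely \<sigma> u p y"
      using decides_uniquely_complete[OF \<sigma> V.el_in[OF u] yV y(2) y(3)] by blast
    then have "y \<in> V.el Y" using Y yV G_P unfolding Q_def by blast
    then have "y \<in> W.el Y" using elts_abs[OF Y(1)] by blast
    moreover have "V.rel g u Y" using V.rel_graph[OF g(2)] u Y by blast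
    ultimately show ?thesis using Y y by blast
  qed
  ultimately show ?thesis using g(1) by blast
qed

end

theorem proposition5p2:
  fixes V W :: "'a set" and E :: "'a \<Rightarrow> 'a \<Rightarrow> bool" and P le :: 'a and G :: "'a set"
  assumes "ZF_model V E"
    and "forcing_notion V E P le"
    and "CCC3 V E P le"
    and "generic_filter V E P le G"
    and "generic_extension V W E P G"
  shows "bukovsky_aleph1 V W E"
  unfolding bukovsky_aleph1_def
proof (intro ballI impI)
  fix x f
  assume x: "x \<in> V" and f: "f \<in> W" "function_on W E f x \<and>
    (\<forall>u\<in>elts W E x. \<forall>y\<in>W. related W E f u y \<longrightarrow> y \<in> V)"
  obtain \<Gamma> where W: "ZF_model W E" "V \<subseteq> W" "\<And>x. x \<in> V \<Longrightarrow> elts W E x \<subseteq> V"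
    and \<Gamma>: "\<Gamma> \<in> W" "elts W E \<Gamma> = G"
      "\<forall>y\<in>W. \<exists>\<sigma>\<in>V. is_name V E P \<sigma> \<and> name_value W E P \<Gamma> \<sigma> y"
    using assms(5) unfolding generic_extension_def by blast
  obtain \<sigma> where \<sigma>: "is_name V E P \<sigma>" "name_value W E P \<Gamma> \<sigma> f" using \<Gamma>(3) f(1) by blast
  obtain T where T: "T \<in> V" "name_closed V E P T" "\<sigma> \<in> elts V E T"
    using \<sigma>(1) unfolding is_name_def by blast
  obtain T' h where T': "T' \<in> W" "name_closed W E P T'" "\<sigma> \<in> elts W E T'"
    and h: "h \<in> W" "function_on W E h T'" "related W E h \<sigma> f"
    and h_rec: "\<forall>\<tau>\<in>elts W E T'. \<forall>v\<in>W. related W E h \<tau> v \<longrightarrow>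
      elts W E v = {z\<in>W. \<exists>\<pi>\<in>elts W E T'. \<exists>p\<in>elts W E \<Gamma>. related W E \<tau> \<pi> p \<and> related W E h \<pi> z}"
    using \<sigma>(2) unfolding name_value_def by (elim bexE conjE) (rule that)
  interpret V: forcing_names V E P le T
    by unfold_locales (use assms T in auto)
  interpret W: ZF W E
    by unfold_locales (rule W)
  \<comment> \<open>The forcing relation is built for the set \<open>T\<close> belonging to the
    chosen name of \<open>f\<close>, not uniformly for all names.\<close>
  obtain R where R: "R \<in> V" "\<forall>p\<in>elts V E P. \<forall>\<pi>\<in>elts V E T. \<forall>c\<in>V.
    V.tri R p \<pi> c \<longleftrightarrow> V.forces_step (V.tri R) p \<pi> c"
    using V.forces_relation_ex by blast
  interpret ext: generic_evaluation V W E P le T G \<Gamma> T' h R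
    by unfold_locales (use assms(4) W \<Gamma>(1,2) T' h R h_rec in simp_all)
  show "\<exists>g\<in>V. function_on V E g x \<and> (\<forall>u\<in>elts V E x. \<exists>c\<in>V. related V E g u c \<and>
    countable_in V E c \<and> (\<exists>y\<in>W. related W E f u y \<and> y \<in> elts W E c))"
    using ext.countable_cover[OF assms(3) T(3) T'(3) h(3) x] f(2) W.rel_components by blast
qed

end
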